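(* Let $k\ge 0$ be an integer, let $X$ be a Bing compactum, let $Y$ be a compactum, and let $f\colon X\to Y$ be a $k$-dimensional map. Then $f$ admits approximation by $k$-dimensional simplicial maps.
   Context: All spaces are separable metrizable; a map is a continuous function; a compactum is a compact (metrizable) space; $\dim$ is covering dimension. A Bing compactum is a compactum each of whose connected components is hereditarily indecomposable (a continuum is hereditarily indecomposable if none of its subcontinua is the union of two proper subcontinua of itself). A map is $k$-dimensional (has dimension at most $k$) if each of its fibers has dimension at most $k$. For a simplicial complex $\mathcal K$, $|\mathcal K|$ is the corresponding polyhedron; a simplicial map $|\mathcal K|\to|\mathcal L|$ is a map sending simplices to simplices and affine on each of them. For an open cover $\omega$ of $X$, a map $\kappa\colon X\to Z$ is an $\omega$-map if $Z$ has an open cover such that the preimage of each of its members is contained in some member of $\omega$. A map $f\colon X\to Y$ admits approximation by $k$-dimensional simplicial maps if for every open cover $\omega_X$ of $X$ and every open cover $\omega_Y$ of $Y$ there exist polyhedra $|\mathcal K|,|\mathcal L|$, an $\omega_X$-map $\kappa_X\colon X\to|\mathcal K|$, an $\omega_Y$-map $\kappa_Y\colon Y\to|\mathcal L|$ and a $k$-dimensional simplicial map $p\colon|\mathcal K|\to|\mathcal L|$ with $p\circ\kappa_X=\kappa_Y\circ f$. *)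

theory Defs
  imports "HOL-Analysis.Analysis"
begin

section \<open>Compacta and Bing compacta\<close>

definition compactum :: "'a topology \<Rightarrow> bool" where
  "compactum X \<longleftrightarrow> compact_space X \<and> metrizable_space X"

text \<open>Metrizability is not repeated here, as it is inherited from the ambient space.\<close>

definition subcontinuum_in :: "'a topology \<Rightarrow> 'a set \<Rightarrow> bool" where
  "subcontinuum_in X C \<longleftrightarrow> C \<noteq> {} \<and> compactin X C \<and> connectedin X C"

definition hereditarily_indecomposable :: "'a topology \<Rightarrow> bool" where
  "hereditarily_indecomposable X \<longleftrightarrow>
     (\<forall>C. subcontinuum_in X C \<longrightarrow>
        \<not> (\<exists>A B. subcontinuum_in X A \<and> subcontinuum_in X B \<and>
                 A \<subset> C \<and> B \<subset> C \<and> C = A \<union> B))"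

definition Bing_compactum :: "'a topology \<Rightarrow> bool" where
  "Bing_compactum X \<longleftrightarrow>
     compactum X \<and>
     (\<forall>C \<in> connected_components_of X. hereditarily_indecomposable (subtopology X C))"

section \<open>Covering dimension\<close>

definition open_cover_of :: "'a topology \<Rightarrow> 'a set set \<Rightarrow> bool" where
  "open_cover_of X \<U> \<longleftrightarrow> (\<forall>U \<in> \<U>. openin X U) \<and> \<Union>\<U> = topspace X"

text \<open>
  The Cech--Lebesgue dimension is at most \<open>n\<close>: finite open covers have finite open refinements
  of order at most \<open>n\<close>, i.e. no point lies in more than \<open>n + 1\<close> members.  The library's
  \<open>dim_le\<close> is the small inductive dimension.
\<close>

definition covering_dim_le :: "'a topology \<Rightarrow> nat \<Rightarrow> bool" where
  "covering_dim_le X n \<longleftrightarrow>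
     (\<forall>\<U>. open_cover_of X \<U> \<and> finite \<U> \<longrightarrow>
        (\<exists>\<V>. open_cover_of X \<V> \<and> finite \<V> \<and>
             (\<forall>V \<in> \<V>. \<exists>U \<in> \<U>. V \<subseteq> U) \<and>
             (\<forall>x \<in> topspace X. card {V \<in> \<V>. x \<in> V} \<le> n + 1)))"

definition dimensional_map :: "nat \<Rightarrow> 'a topology \<Rightarrow> 'b topology \<Rightarrow> ('a \<Rightarrow> 'b) \<Rightarrow> bool" where
  "dimensional_map k X Y f \<longleftrightarrow>
     continuous_map X Y f \<and>
     (\<forall>y \<in> topspace Y. covering_dim_le (subtopology X {x \<in> topspace X. f x = y}) k)"

section \<open>Polyhedra and simplicial maps\<close>

text \<open>
  The library's \<open>simplicial_complex\<close> consists of finitely many simplices in a Euclidean space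
  whose dimension is fixed by its type.  Here a complex is given abstractly by the family of
  vertex sets of its (nonempty) simplices, and is realized by barycentric coordinates.
\<close>

definition abstract_complex :: "'v set set \<Rightarrow> bool" where
  "abstract_complex K \<longleftrightarrow>
     (\<forall>\<sigma> \<in> K. finite \<sigma> \<and> \<sigma> \<noteq> {} \<and> (\<forall>\<tau>. \<tau> \<subseteq> \<sigma> \<and> \<tau> \<noteq> {} \<longrightarrow> \<tau> \<in> K))"

definition locally_finite_complex :: "'v set set \<Rightarrow> bool" where
  "locally_finite_complex K \<longleftrightarrow> abstract_complex K \<and> (\<forall>v. finite {\<sigma> \<in> K. v \<in> \<sigma>})"

definition closed_simplex_on :: "'v set \<Rightarrow> ('v \<Rightarrow> real) set" where
  "closed_simplex_on \<sigma> =
     {x. (\<forall>v. 0 \<le> x v) \<and> (\<forall>v. v \<notin> \<sigma> \<longrightarrow> x v = 0) \<and> (\<Sum>v\<in>\<sigma>. x v) = 1}"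

text \<open>
  The topology of pointwise convergence of barycentric coordinates.  On the realization of any
  complex it is the metric topology, and on that of a locally finite complex it is also the weak
  (Whitehead) topology.
\<close>

definition polyhedron_of :: "'v set set \<Rightarrow> ('v \<Rightarrow> real) topology" where
  "polyhedron_of K = subtopology (powertop_real UNIV) (\<Union>\<sigma>\<in>K. closed_simplex_on \<sigma>)"

definition simplicial_map_between ::
    "'v set set \<Rightarrow> 'w set set \<Rightarrow> (('v \<Rightarrow> real) \<Rightarrow> ('w \<Rightarrow> real)) \<Rightarrow> bool" where
  "simplicial_map_between K L p \<longleftrightarrow>
     continuous_map (polyhedron_of K) (polyhedron_of L) p \<and>
     (\<forall>\<sigma> \<in> K.
        (\<exists>\<tau> \<in> L. p ` closed_simplex_on \<sigma> = closed_simplex_on \<tau>) \<and>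
        (\<forall>x \<in> closed_simplex_on \<sigma>. \<forall>y \<in> closed_simplex_on \<sigma>. \<forall>t. 0 \<le> t \<and> t \<le> 1 \<longrightarrow>
           p (\<lambda>v. (1 - t) * x v + t * y v) = (\<lambda>w. (1 - t) * p x w + t * p y w)))"

section \<open>Approximation by simplicial maps\<close>

definition omega_map :: "'a topology \<Rightarrow> 'a set set \<Rightarrow> 'z topology \<Rightarrow> ('a \<Rightarrow> 'z) \<Rightarrow> bool" where
  "omega_map X \<omega> Z \<kappa> \<longleftrightarrow>
     continuous_map X Z \<kappa> \<and>
     (\<exists>\<W>. open_cover_of Z \<W> \<and> (\<forall>W \<in> \<W>. \<exists>U \<in> \<omega>. {x \<in> topspace X. \<kappa> x \<in> W} \<subseteq> U))"

text \<open>
  All spaces, polyhedra included, are separable metrizable.  For the weak topology this means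
  that the complexes are countable and locally finite, so that their vertices may be taken to be
  natural numbers.
\<close>

definition admits_simplicial_approximation ::
    "nat \<Rightarrow> 'a topology \<Rightarrow> 'b topology \<Rightarrow> ('a \<Rightarrow> 'b) \<Rightarrow> bool" where
  "admits_simplicial_approximation k X Y f \<longleftrightarrow>
     (\<forall>\<omega>X \<omega>Y. open_cover_of X \<omega>X \<and> open_cover_of Y \<omega>Y \<longrightarrow>
        (\<exists>(K :: nat set set) (L :: nat set set) \<kappa>X \<kappa>Y p.
           locally_finite_complex K \<and> locally_finite_complex L \<and>
           omega_map X \<omega>X (polyhedron_of K) \<kappa>X \<and>
           omega_map Y \<omega>Y (polyhedron_of L) \<kappa>Y \<and>
           simplicial_map_between K L p \<and>
           dimensional_map k (polyhedron_of K) (polyhedron_of L) p \<and>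
           (\<forall>x \<in> topspace X. p (\<kappa>X x) = \<kappa>Y (f x))))"

end

theory Submission
  imports Defs
begin

text \<open>
  Call a point \<open>x\<close> of \<open>X\<close> thick if the component of its fibre through \<open>x\<close> is large.  Two continua
  in a Bing compactum that meet are nested, so a small continuum that meets a large continuum lying
  in a fibre is itself contained in that fibre.  Hence every component of a small closed piece of
  the thick part lies in a fibre, and the thick part has dimension at most \<open>k\<close>, although
  nothing is known about the dimension of \<open>Y\<close>.

  Take small open sets of order at most \<open>k + 1\<close> that cover the thick part.  Over a small open set
  \<open>U\<close> of \<open>Y\<close> the preimage splits into one open piece covered by these sets and finitely many small
  disjoint ones.  Near the first piece \<open>X\<close> is mapped to the product of the nerve \<open>L\<close> of a cover of
  \<open>Y\<close> and the \<open>k\<close>-dimensional nerve of the cover of the thick part, with its staircase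
  triangulation; the other pieces contribute one vertex each over \<open>U\<close>.  The projection to \<open>L\<close> is
  simplicial, and its fibres have dimension at most \<open>k\<close>.
\<close>

section \<open>Covering dimension\<close>

text \<open>The obstacle is that the nerve \<open>L\<close> may have any dimension, so bounding the
  dimension of the complex above it would be of no use. What is bounded is the excess of a simplex,
  that is, the number of its vertices minus the number of their images in \<open>L\<close>: a point
  of a fibre inside the simplex is determined by that many coordinates. A staircase path through a
  grid with at most k + 1 columns has excess at most k, which is how k + 1 sets at a point lead to
  fibres of dimension k. A thin piece puts a single vertex over its vertex of \<open>L\<close> and
  has excess 0. A point may lie in thick pieces over some sets \<open>U\<close> and in thin pieces
  over others; only the thick ones contribute, and they do so through one common staircase. No
  interpolation between the two kinds of pieces is needed: every piece is open and closed in the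
  preimage of its \<open>U\<close>, and its coordinates are bounded by the weight of
  \<open>U\<close>, which vanishes outside \<open>U\<close>. Indecomposability enters through the
  nestedness of meeting subcontinua.\<close>

text \<open>The order is counted by indices, so repeated members cause no trouble, and it is bounded
  on all of \<open>X\<close> although only \<open>A\<close> has to be covered: the members will be
  used outside \<open>A\<close> as well.\<close>

definition shrinking_of_order ::
    "'a topology \<Rightarrow> 'a set \<Rightarrow> nat \<Rightarrow> nat \<Rightarrow> (nat \<Rightarrow> 'a set) \<Rightarrow> (nat \<Rightarrow> 'a set) \<Rightarrow> bool" where
  "shrinking_of_order X A n m U V \<longleftrightarrow>
     (\<forall>i<m. openin X (V i) \<and> V i \<subseteq> U i) \<and> A \<subseteq> (\<Union>i<m. V i) \<and>
     (\<forall>x \<in> topspace X. card {i. i < m \<and> x \<in> V i} \<le> n + 1)"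

text \<open>The members of a refinement that are assigned to the same \<open>U i\<close> are merged.
  The order does not grow, since distinct indices at a point come from distinct members of the
  refinement. Conversely, the members of an indexed family at a point are at most as many as their
  indices.\<close>

lemma covering_dim_le_iff_shrinking:
  "covering_dim_le X n \<longleftrightarrow>
     (\<forall>m U. (\<forall>i<m. openin X (U i)) \<and> topspace X \<subseteq> (\<Union>i<m. U i) \<longrightarrow>
        (\<exists>V. shrinking_of_order X (topspace X) n m U V))" (is "?L \<longleftrightarrow> ?R")
proof
  assume L: ?L
  show ?R
  proof (intro allI impI)
    fix m and U :: "nat \<Rightarrow> 'a set"
    assume U: "(\<forall>i<m. openin X (U i)) \<and> topspace X \<subseteq> (\<Union>i<m. U i)"
    then have "open_cover_of X (U ` {..<m})"
      using openin_subset by (fastforce simp: open_cover_of_def)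
    then obtain \<V> where \<V>: "open_cover_of X \<V>" "finite \<V>" "\<forall>V \<in> \<V>. \<exists>U' \<in> U ` {..<m}. V \<subseteq> U'"
        "\<forall>x \<in> topspace X. card {V \<in> \<V>. x \<in> V} \<le> n + 1"
      using L unfolding covering_dim_le_def by blast
    from \<V>(3) have "\<forall>V\<in>\<V>. \<exists>i<m. V \<subseteq> U i" by blast
    then obtain g where g: "\<And>V. V \<in> \<V> \<Longrightarrow> g V < m \<and> V \<subseteq> U (g V)" by metis
    define W where "W i = \<Union>{V \<in> \<V>. g V = i}" for i
    have "card {i. i < m \<and> x \<in> W i} \<le> n + 1" if "x \<in> topspace X" for x
    proof -
      have "{i. i < m \<and> x \<in> W i} \<subseteq> g ` {V \<in> \<V>. x \<in> V}"
        by (auto simp: W_def)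
      then have "card {i. i < m \<and> x \<in> W i} \<le> card (g ` {V \<in> \<V>. x \<in> V})"
        using \<V>(2) by (intro card_mono) auto
      also have "\<dots> \<le> card {V \<in> \<V>. x \<in> V}"
        using \<V>(2) by (intro card_image_le) auto
      finally show ?thesis using \<V>(4) that by fastforce
    qed
    moreover have "\<forall>i<m. openin X (W i) \<and> W i \<subseteq> U i"
      using \<V>(1) g by (auto simp: W_def open_cover_of_def)
    moreover have "topspace X \<subseteq> (\<Union>i<m. W i)"
    proof
      fix x assume "x \<in> topspace X"
      then obtain V where "V \<in> \<V>" "x \<in> V" using \<V>(1) by (auto simp: open_cover_of_def)
      then show "x \<in> (\<Union>i<m. W i)" using g unfolding W_def by blast
    qed
    ultimately show "\<exists>V. shrinking_of_order X (topspace X) n m U V"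
      unfolding shrinking_of_order_def by blast
  qed
next
  assume R: ?R
  show ?L
    unfolding covering_dim_le_def
  proof (intro allI impI)
    fix \<U> assume \<U>: "open_cover_of X \<U> \<and> finite \<U>"
    then obtain U and m :: nat where U: "\<U> = U ` {..<m}"
      by (metis finite_imp_nat_seg_image_inj_on lessThan_def)
    with \<U> R obtain V where V: "shrinking_of_order X (topspace X) n m U V"
      unfolding open_cover_of_def by (metis (no_types, lifting) imageI lessThan_iff order_refl)
    have "card {W \<in> V ` {..<m}. x \<in> W} \<le> n + 1" if "x \<in> topspace X" for x
    proof -
      have "{W \<in> V ` {..<m}. x \<in> W} = V ` {i. i < m \<and> x \<in> V i}" by auto
      then have "card {W \<in> V ` {..<m}. x \<in> W} \<le> card {i. i < m \<and> x \<in> V i}"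
        by (simp add: card_image_le)
      with V that show ?thesis by (force simp: shrinking_of_order_def)
    qed
    moreover have "open_cover_of X (V ` {..<m})"
      using V openin_subset by (fastforce simp: open_cover_of_def shrinking_of_order_def)
    moreover have "\<forall>W \<in> V ` {..<m}. \<exists>U' \<in> \<U>. W \<subseteq> U'"
      using V U by (force simp: shrinking_of_order_def)
    ultimately show "\<exists>\<V>. open_cover_of X \<V> \<and> finite \<V> \<and>
             (\<forall>V \<in> \<V>. \<exists>U \<in> \<U>. V \<subseteq> U) \<and> (\<forall>x \<in> topspace X. card {V \<in> \<V>. x \<in> V} \<le> n + 1)"
      by (intro exI[of _ "V ` {..<m}"]) auto
  qed
qed

lemma covering_dim_le_shrinking:
  assumes "covering_dim_le X n" "\<And>i. i < m \<Longrightarrow> openin X (U i)" "topspace X \<subseteq> (\<Union>i<m. U i)"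
  obtains V where "shrinking_of_order X (topspace X) n m U V"
  using assms unfolding covering_dim_le_iff_shrinking by meson

text \<open>Adding the complement of \<open>A\<close> to each relatively open set gives an open
  cover of the whole space, whose shrinking is cut down to \<open>A\<close>. The case
  \<open>A = {}\<close> stands apart because \<open>m = 0\<close> is possible there, and then no
  index is left to carry the complement.\<close>

lemma covering_dim_le_closed_subspace:
  assumes X: "covering_dim_le X n" and A: "closedin X A"
  shows "covering_dim_le (subtopology X A) n"
  unfolding covering_dim_le_iff_shrinking
proof (intro allI impI)
  fix m and U :: "nat \<Rightarrow> 'a set"
  assume U: "(\<forall>i<m. openin (subtopology X A) (U i)) \<and> topspace (subtopology X A) \<subseteq> (\<Union>i<m. U i)"
  have AX: "A \<subseteq> topspace X" using A closedin_subset by blast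
  have "\<forall>i<m. \<exists>T. openin X T \<and> U i = T \<inter> A"
    using U by (auto simp: openin_subtopology)
  then obtain T where T: "\<And>i. i < m \<Longrightarrow> openin X (T i) \<and> U i = T i \<inter> A" by metis
  define T' where "T' i = T i \<union> (topspace X - A)" for i
  show "\<exists>V. shrinking_of_order (subtopology X A) (topspace (subtopology X A)) n m U V"
  proof (cases "A = {}")
    case True
    then show ?thesis by (intro exI[of _ "\<lambda>_. {}"]) (auto simp: shrinking_of_order_def)
  next
    case False
    then have "m > 0" using U AX by (auto intro: gr0I)
    have "openin X (T' i)" if "i < m" for i using T A that unfolding T'_def by auto
    moreover have "topspace X \<subseteq> (\<Union>i<m. T' i)"
    proof
      fix x assume x: "x \<in> topspace X"
      show "x \<in> (\<Union>i<m. T' i)"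
      proof (cases "x \<in> A")
        case True
        then have "x \<in> (\<Union>i<m. U i)" using U x by auto
        then show ?thesis using T by (auto simp: T'_def)
      next
        case False
        then show ?thesis using x \<open>m > 0\<close> by (auto simp: T'_def)
      qed
    qed
    ultimately obtain V where V: "shrinking_of_order X (topspace X) n m T' V"
      using covering_dim_le_shrinking[OF X] by metis
    have "card {i. i < m \<and> x \<in> V i \<inter> A} \<le> n + 1" if "x \<in> topspace X" for x
    proof -
      have "card {i. i < m \<and> x \<in> V i \<inter> A} \<le> card {i. i < m \<and> x \<in> V i}"
        by (intro card_mono) auto
      then show ?thesis using V that by (force simp: shrinking_of_order_def)
    qed
    moreover have "V i \<inter> A \<subseteq> U i" if "i < m" for i
      using V T that by (auto simp: shrinking_of_order_def T'_def)
    ultimately have "shrinking_of_order (subtopology X A) (topspace (subtopology X A)) n m U (\<lambda>i. V i \<inter> A)"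
      using V AX by (auto simp: shrinking_of_order_def openin_subtopology)
    then show ?thesis by blast
  qed
qed

text \<open>The closed sets are treated one after another. At stage \<open>p\<close> the current
  cover is changed on \<open>A p\<close> only, where a shrinking relative to \<open>A p\<close>
  replaces it; the members stay open because \<open>A p\<close> is closed. They only get smaller, so
  the bounds reached on earlier sets persist.\<close>

lemma covering_dim_le_finite_closed_Union:
  fixes X :: "'a topology" and A :: "nat \<Rightarrow> 'a set"
  assumes A: "\<And>l. l < q \<Longrightarrow> closedin X (A l)"
    and dim: "\<And>l. l < q \<Longrightarrow> covering_dim_le (subtopology X (A l)) n"
    and cov: "topspace X \<subseteq> (\<Union>l<q. A l)"
  shows "covering_dim_le X n"
proof -
  have "\<exists>V. (\<forall>i<m. openin X (V i) \<and> V i \<subseteq> U i) \<and> topspace X \<subseteq> (\<Union>i<m. V i) \<and>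
           (\<forall>x \<in> (\<Union>l<p. A l). card {i. i < m \<and> x \<in> V i} \<le> n + 1)"
    if "p \<le> q" "\<forall>i<m. openin X (U i)" "topspace X \<subseteq> (\<Union>i<m. U i)" for m p and U :: "nat \<Rightarrow> 'a set"
    using that
  proof (induction p)
    case 0
    then show ?case by (intro exI[of _ U]) auto
  next
    case (Suc p)
    then have "\<exists>V. (\<forall>i<m. openin X (V i) \<and> V i \<subseteq> U i) \<and> topspace X \<subseteq> (\<Union>i<m. V i) \<and>
        (\<forall>x \<in> (\<Union>l<p. A l). card {i. i < m \<and> x \<in> V i} \<le> n + 1)" by simp
    then obtain V where V: "\<And>i. i < m \<Longrightarrow> openin X (V i) \<and> V i \<subseteq> U i" "topspace X \<subseteq> (\<Union>i<m. V i)"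
      "\<And>x. x \<in> (\<Union>l<p. A l) \<Longrightarrow> card {i. i < m \<and> x \<in> V i} \<le> n + 1" by metis
    have p: "p < q" using Suc.prems by simp
    have AX: "A p \<subseteq> topspace X" using A[OF p] closedin_subset by blast
    have "topspace (subtopology X (A p)) \<subseteq> (\<Union>i<m. V i \<inter> A p)" using V(2) AX by auto
    moreover have "openin (subtopology X (A p)) (V i \<inter> A p)" if "i < m" for i
      using V(1) that by (auto simp: openin_subtopology)
    ultimately obtain W where
      W: "shrinking_of_order (subtopology X (A p)) (topspace (subtopology X (A p))) n m (\<lambda>i. V i \<inter> A p) W"
      using covering_dim_le_shrinking[OF dim[OF p]] by metis
    then have W1: "\<And>i. i < m \<Longrightarrow> openin (subtopology X (A p)) (W i) \<and> W i \<subseteq> V i \<inter> A p"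
      and W2: "A p \<subseteq> (\<Union>i<m. W i)"
      and W3: "\<And>x. x \<in> A p \<Longrightarrow> card {i. i < m \<and> x \<in> W i} \<le> n + 1"
      using AX by (auto simp: shrinking_of_order_def)
    define V' where "V' i = (V i - A p) \<union> W i" for i
    have "openin X (V' i)" if i: "i < m" for i
    proof -
      obtain T where T: "openin X T" "W i = T \<inter> A p" using W1[OF i] by (auto simp: openin_subtopology)
      have "V' i = (V i - A p) \<union> (V i \<inter> T)"
        using W1[OF i] T by (auto simp: V'_def)
      then show ?thesis using V(1)[OF i] T(1) A[OF p] by auto
    qed
    moreover have sub: "V' i \<subseteq> V i" if "i < m" for i using W1[OF that] by (auto simp: V'_def)
    moreover have "topspace X \<subseteq> (\<Union>i<m. V' i)"
      using V(2) W2 by (fastforce simp: V'_def)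
    moreover have "card {i. i < m \<and> x \<in> V' i} \<le> n + 1" if x: "x \<in> (\<Union>l<Suc p. A l)" for x
    proof (cases "x \<in> A p")
      case True
      then have "{i. i < m \<and> x \<in> V' i} = {i. i < m \<and> x \<in> W i}" by (auto simp: V'_def)
      then show ?thesis using W3[OF True] by simp
    next
      case False
      then have "x \<in> (\<Union>l<p. A l)" using x less_Suc_eq by auto
      moreover have "card {i. i < m \<and> x \<in> V' i} \<le> card {i. i < m \<and> x \<in> V i}"
        using sub by (intro card_mono) auto
      ultimately show ?thesis using V(3) by fastforce
    qed
    ultimately show ?case using V(1) by (meson order_trans)
  qed
  note * = this
  show ?thesis
    unfolding covering_dim_le_iff_shrinking shrinking_of_order_def
  proof (intro allI impI)
    fix m and U :: "nat \<Rightarrow> 'a set"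
    assume "(\<forall>i<m. openin X (U i)) \<and> topspace X \<subseteq> (\<Union>i<m. U i)"
    then have "\<exists>V. (\<forall>i<m. openin X (V i) \<and> V i \<subseteq> U i) \<and> topspace X \<subseteq> (\<Union>i<m. V i) \<and>
        (\<forall>x \<in> (\<Union>l<q. A l). card {i. i < m \<and> x \<in> V i} \<le> n + 1)"
      using *[of q m U] by simp
    then obtain V where "\<forall>i<m. openin X (V i) \<and> V i \<subseteq> U i" "topspace X \<subseteq> (\<Union>i<m. V i)"
        "\<forall>x \<in> (\<Union>l<q. A l). card {i. i < m \<and> x \<in> V i} \<le> n + 1"
      by metis
    moreover from this(3) have "\<forall>x\<in>topspace X. card {i. i < m \<and> x \<in> V i} \<le> n + 1"
      using cov by (meson subsetD)
    ultimately show "\<exists>V. (\<forall>i<m. openin X (V i) \<and> V i \<subseteq> U i) \<and> topspace X \<subseteq> (\<Union>i<m. V i) \<and>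
        (\<forall>x\<in>topspace X. card {i. i < m \<and> x \<in> V i} \<le> n + 1)"
      by metis
  qed
qed

section \<open>Open families on a compact subset, extended to the whole space\<close>

lemma nearest_point_exists:
  assumes "Metric_space M d" and A: "compactin (Metric_space.mtopology M d) A" "A \<noteq> {}" and x: "x \<in> M"
  obtains z where "z \<in> A" "\<And>w. w \<in> A \<Longrightarrow> d x z \<le> d x w"
proof -
  interpret Metric_space M d by fact
  have "continuous_map mtopology euclideanreal (d x)"
    using continuous_on_mdist[of x Self] x by (simp add: mtopology_of_def)
  then have "compact (d x ` A)"
    using image_compactin[OF A(1)] by force
  then show ?thesis
    using compact_attains_inf[of "d x ` A"] A(2) that by auto
qed

text \<open>
  Extension by nearest points does not raise the order: all members of the extended family that
  contain \<open>x\<close> already contain every point of \<open>A\<close> nearest to \<open>x\<close>.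
\<close>

lemma extend_open_family:
  assumes X: "metrizable_space X" and A: "compactin X A" "A \<noteq> {}"
    and W: "\<And>i. i \<in> I \<Longrightarrow> openin (subtopology X A) (W i)"
  obtains W' where "\<And>i. i \<in> I \<Longrightarrow> openin X (W' i)" "\<And>i. i \<in> I \<Longrightarrow> W' i \<inter> A = W i"
    "\<And>x. x \<in> topspace X \<Longrightarrow> \<exists>z\<in>A. \<forall>i\<in>I. x \<in> W' i \<longrightarrow> z \<in> W i"
proof -
  obtain M d where M: "Metric_space M d" and XM: "X = Metric_space.mtopology M d"
    using X by (auto simp: metrizable_space_def)
  interpret Metric_space M d by fact
  have top: "topspace X = M" by (simp add: XM)
  have AM: "A \<subseteq> M" using A(1) compactin_subset_topspace top by blast
  define near where "near x = {z \<in> A. \<forall>w\<in>A. d x z \<le> d x w}" for x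
  \<comment> \<open>Asking for all nearest points, and not just for one, makes \<open>W' i\<close>
    open: it means that \<open>x\<close> is strictly closer to \<open>A\<close> than to the compact
    set \<open>A - W i\<close>.\<close>
  define W' where "W' i = {x \<in> M. near x \<subseteq> W i}" for i
  have ne: "near x \<noteq> {}" if "x \<in> M" for x
  proof -
    obtain z where "z \<in> A" "\<And>w. w \<in> A \<Longrightarrow> d x z \<le> d x w"
      using nearest_point_exists[OF M A[unfolded XM] \<open>x \<in> M\<close>] by metis
    then have "z \<in> near x" by (simp add: near_def)
    then show ?thesis by blast
  qed
  have nearA: "near x = {x}" if "x \<in> A" for x
  proof -
    have "near x \<subseteq> {x}"
    proof
      fix z assume z: "z \<in> near x"
      then have "d x z \<le> d x x" using that unfolding near_def by blast
      then have "d x z = 0" using that AM nonneg[of x z] mdist_zero[of x] by fastforce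
      then show "z \<in> {x}" using zero[of x z] z that AM by (auto simp: near_def)
    qed
    then show ?thesis using ne[of x] that AM by auto
  qed
  have "openin X (W' i)" if i: "i \<in> I" for i
  proof -
    have WA: "W i \<subseteq> A" using W[OF i] openin_subset by fastforce
    have "compactin X (A - W i)"
    proof -
      have "closedin (subtopology X A) (A - W i)"
        using W[OF i] AM top by (metis closedin_diff closedin_topspace topspace_subtopology_subset)
      then have "compactin (subtopology X A) (A - W i)"
        using A(1) closedin_compact_space compact_space_subtopology by blast
      then show ?thesis by (simp add: compactin_subtopology)
    qed
    note B = this
    show ?thesis
      unfolding XM openin_mtopology
    proof (intro conjI allI impI)
      show "W' i \<subseteq> M" by (auto simp: W'_def)
      fix x assume x: "x \<in> W' i"
      then have xM: "x \<in> M" and nx: "near x \<subseteq> W i" by (auto simp: W'_def)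
      show "\<exists>r>0. mball x r \<subseteq> W' i"
      proof (cases "A - W i = {}")
        case True
        then have "W' i = M" using WA by (auto simp: W'_def near_def)
        then have "mball x 1 \<subseteq> W' i" by (simp add: subset_iff)
        then show ?thesis using zero_less_one by blast
      next
        case False
        obtain b where b: "b \<in> A - W i" "\<And>w. w \<in> A - W i \<Longrightarrow> d x b \<le> d x w"
          using nearest_point_exists[OF M B[unfolded XM] False xM] by metis
        obtain a where a: "a \<in> near x" using ne[OF xM] by auto
        then have aA: "a \<in> A" by (auto simp: near_def)
        have "b \<notin> near x" using nx b by auto
        then obtain w where "w \<in> A" "d x w < d x b" using b(1) by (auto simp: near_def not_le)
        then have lt: "d x a < d x b" using a by (force simp: near_def)
        \<comment> \<open>Half of the gap, because replacing \<open>x\<close> by \<open>y\<close>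
          costs \<open>d x y\<close> twice: once for the distance to \<open>z\<close> and once for
          the distance to \<open>a\<close>.\<close>
        define r where "r = (d x b - d x a) / 2"
        have "mball x r \<subseteq> W' i"
        proof
          fix y assume y: "y \<in> mball x r"
          then have yM: "y \<in> M" and dxy: "d x y < r" by auto
          have "z \<in> W i" if z: "z \<in> near y" for z
          proof (rule ccontr)
            assume "z \<notin> W i"
            then have zb: "d x b \<le> d x z" using z b by (auto simp: near_def)
            have "d y z \<le> d y a" using z aA by (auto simp: near_def)
            moreover have "d x z \<le> d x y + d y z"
              using xM yM z AM by (intro triangle) (auto simp: near_def)
            moreover have "d y a \<le> d y x + d x a" using xM yM aA AM by (intro triangle) auto
            moreover have "d y x = d x y" by (rule commute)
            ultimately show False using zb dxy r_def by (simp add: field_simps)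
          qed
          then show "y \<in> W' i" using yM by (auto simp: W'_def)
        qed
        moreover have "r > 0" using lt by (simp add: r_def)
        ultimately show ?thesis by blast
      qed
    qed
  qed
  moreover have "W' i \<inter> A = W i" if i: "i \<in> I" for i
  proof -
    have "W i \<subseteq> A" using W[OF i] openin_subset by fastforce
    then show ?thesis using AM nearA by (auto simp: W'_def)
  qed
  moreover have "\<exists>z\<in>A. \<forall>i\<in>I. x \<in> W' i \<longrightarrow> z \<in> W i" if "x \<in> topspace X" for x
  proof -
    have "near x \<noteq> {}" using ne[of x] that top by simp
    then obtain z where "z \<in> near x" by blast
    then show ?thesis by (intro bexI[of _ z]) (auto simp: W'_def near_def)
  qed
  ultimately show ?thesis using that by blast
qed

text \<open>The dimension of a subspace speaks of relatively open sets only. A shrinking inside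
  \<open>A\<close> is spread over the space by nearest points and cut back to the sets
  \<open>U i\<close>; at any point it has at most the order that it had at some point of
  \<open>A\<close>.\<close>

lemma compact_covering_dim_le_shrinking:
  assumes X: "metrizable_space X" and A: "compactin X A"
    and dim: "covering_dim_le (subtopology X A) n"
    and U: "\<And>i. i < m \<Longrightarrow> openin X (U i)" "A \<subseteq> (\<Union>i<m. U i)"
  obtains V where "shrinking_of_order X A n m U V"
proof (cases "A = {}")
  case True
  then have "shrinking_of_order X A n m U (\<lambda>_. {})" by (auto simp: shrinking_of_order_def)
  then show ?thesis using that by blast
next
  case False
  have AX: "A \<subseteq> topspace X" using A compactin_subset_topspace by blast
  have "openin (subtopology X A) (U i \<inter> A)" if "i < m" for i
    using U(1) that by (auto simp: openin_subtopology)
  moreover have "topspace (subtopology X A) \<subseteq> (\<Union>i<m. U i \<inter> A)" using U(2) by auto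
  ultimately obtain W where
    W: "shrinking_of_order (subtopology X A) (topspace (subtopology X A)) n m (\<lambda>i. U i \<inter> A) W"
    using covering_dim_le_shrinking[OF dim] by metis
  then have Wop: "\<And>i. i \<in> {..<m} \<Longrightarrow> openin (subtopology X A) (W i)"
    by (auto simp: shrinking_of_order_def)
  obtain W' where W': "\<And>i. i \<in> {..<m} \<Longrightarrow> openin X (W' i)" "\<And>i. i \<in> {..<m} \<Longrightarrow> W' i \<inter> A = W i"
    "\<And>x. x \<in> topspace X \<Longrightarrow> \<exists>z\<in>A. \<forall>i\<in>{..<m}. x \<in> W' i \<longrightarrow> z \<in> W i"
    using extend_open_family[OF X A False, of "{..<m}" W] Wop by metis
  have "card {i. i < m \<and> x \<in> W' i \<inter> U i} \<le> n + 1" if x: "x \<in> topspace X" for x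
  proof -
    obtain z where z: "z \<in> A" "\<forall>i\<in>{..<m}. x \<in> W' i \<longrightarrow> z \<in> W i" using W'(3)[OF x] by blast
    have "card {i. i < m \<and> x \<in> W' i \<inter> U i} \<le> card {i. i < m \<and> z \<in> W i}"
      using z(2) by (intro card_mono) auto
    also have "\<dots> \<le> n + 1" using W z(1) AX by (auto simp: shrinking_of_order_def)
    finally show ?thesis .
  qed
  moreover have "A \<subseteq> (\<Union>i<m. W' i \<inter> U i)"
  proof
    fix x assume x: "x \<in> A"
    then obtain i where "i < m" "x \<in> W i" using W AX by (auto simp: shrinking_of_order_def)
    then show "x \<in> (\<Union>i<m. W' i \<inter> U i)" using W'(2)[of i] W by (auto simp: shrinking_of_order_def)
  qed
  ultimately have "shrinking_of_order X A n m U (\<lambda>i. W' i \<inter> U i)"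
    using W'(1) U(1) by (auto simp: shrinking_of_order_def)
  then show ?thesis using that by blast
qed

section \<open>Clopen sets, and the dimension of a compactum through its components\<close>

text \<open>In a compact Hausdorff space components are quasi-components: by maximality of
  \<open>C\<close> no connected set joins it to the complement of \<open>V\<close>, so a clopen set
  separates the two.\<close>

lemma clopen_neighbourhood_of_component:
  assumes X: "compact_space X" "Hausdorff_space X" and C: "C \<in> connected_components_of X"
    and V: "openin X V" "C \<subseteq> V"
  obtains H where "openin X H" "closedin X H" "C \<subseteq> H" "H \<subseteq> V"
proof -
  have "separated_between X C (topspace X - V)"
  proof (rule cut_wire_fence_theorem[OF X])
    show "closedin X C" using C closedin_connected_components_of by blast
    show "closedin X (topspace X - V)" using V by auto
    fix D assume D: "connectedin X D"
    show "disjnt D C \<or> disjnt D (topspace X - V)"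
      using connected_components_of_maximal[OF C D] V(2) by (auto simp: disjnt_iff)
  qed
  then obtain H K where HK: "openin X H" "openin X K" "H \<union> K = topspace X" "disjnt H K" "C \<subseteq> H"
      "topspace X - V \<subseteq> K" unfolding separated_between_def by blast
  have "H = topspace X - K" using HK(3,4) by (auto simp: disjnt_iff)
  then have "closedin X H" "H \<subseteq> V" using HK by auto
  then show ?thesis using that HK by blast
qed

lemma disjoint_clopen_refinement:
  fixes H :: "nat \<Rightarrow> 'a set"
  assumes "\<And>l. l < q \<Longrightarrow> openin X (H l) \<and> closedin X (H l)" and "l < q"
  shows "openin X (H l - (\<Union>l'<l. H l'))"
proof -
  have "closedin X (\<Union>l'<l. H l')"
    using assms by (intro closedin_Union) auto
  then show ?thesis using assms by auto
qed

text \<open>A shrinking that covers one component still covers a clopen neighbourhood of it, and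
  finitely many of these neighbourhoods cover the space. Made disjoint, they allow the local
  families to be glued without raising the order.\<close>

lemma covering_dim_le_components:
  assumes X: "compact_space X" "metrizable_space X"
    and dim: "\<And>C. C \<in> connected_components_of X \<Longrightarrow> covering_dim_le (subtopology X C) n"
  shows "covering_dim_le X n"
  unfolding covering_dim_le_iff_shrinking
proof (intro allI impI)
  fix m and U :: "nat \<Rightarrow> 'a set"
  assume U: "(\<forall>i<m. openin X (U i)) \<and> topspace X \<subseteq> (\<Union>i<m. U i)"
  have Haus: "Hausdorff_space X" using X(2) by (rule metrizable_imp_Hausdorff_space)
  have "\<exists>H V. openin X H \<and> closedin X H \<and> C \<subseteq> H \<and> H \<subseteq> (\<Union>i<m. V i) \<and> shrinking_of_order X C n m U V"
    if C: "C \<in> connected_components_of X" for C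
  proof -
    have "compactin X C" using C X(1) closedin_compact_space closedin_connected_components_of by blast
    moreover have "C \<subseteq> (\<Union>i<m. U i)" using C U connected_components_of_subset by blast
    ultimately obtain V where V: "shrinking_of_order X C n m U V"
      using compact_covering_dim_le_shrinking[OF X(2) _ dim[OF C]] U by metis
    moreover have "openin X (\<Union>i<m. V i)" using V by (auto simp: shrinking_of_order_def)
    moreover have "C \<subseteq> (\<Union>i<m. V i)" using V by (auto simp: shrinking_of_order_def)
    ultimately obtain H where "openin X H" "closedin X H" "C \<subseteq> H" "H \<subseteq> (\<Union>i<m. V i)"
      using clopen_neighbourhood_of_component[OF X(1) Haus C] by metis
    then show ?thesis using V by blast
  qed
  then obtain H V where HV: "\<And>C. C \<in> connected_components_of X \<Longrightarrow> openin X (H C) \<and> closedin X (H C) \<and>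
      C \<subseteq> H C \<and> H C \<subseteq> (\<Union>i<m. V C i) \<and> shrinking_of_order X C n m U (V C)"
    by metis
  have "topspace X \<subseteq> \<Union>(H ` connected_components_of X)"
  proof
    fix x assume "x \<in> topspace X"
    then obtain C where "C \<in> connected_components_of X" "x \<in> C"
      using Union_connected_components_of[of X] by blast
    then show "x \<in> \<Union>(H ` connected_components_of X)" using HV[of C] by blast
  qed
  then obtain \<F> where \<F>: "finite \<F>" "\<F> \<subseteq> H ` connected_components_of X" "topspace X \<subseteq> \<Union>\<F>"
    using X(1) HV unfolding compact_space_alt by (metis (mono_tags, lifting) imageE)
  then obtain \<C> where \<C>: "finite \<C>" "\<C> \<subseteq> connected_components_of X" "topspace X \<subseteq> \<Union>(H ` \<C>)"
    using finite_subset_image[OF \<F>(1,2)] \<F>(3) by metis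
  then obtain c and q :: nat where c: "\<C> = c ` {..<q}"
    by (metis finite_imp_nat_seg_image_inj_on lessThan_def)
  have HVc: "openin X (H (c l)) \<and> closedin X (H (c l)) \<and>
      H (c l) \<subseteq> (\<Union>i<m. V (c l) i) \<and> shrinking_of_order X (c l) n m U (V (c l))" if "l < q" for l
    using HV[of "c l"] c \<C>(2) that by blast
  define D where "D l = H (c l) - (\<Union>l'<l. H (c l'))" for l
  have Dop: "openin X (D l)" if "l < q" for l
    unfolding D_def using HVc that by (intro disjoint_clopen_refinement[where H="\<lambda>l. H (c l)" and q=q]) auto
  have Dcov: "\<exists>l<q. x \<in> D l" if x: "x \<in> topspace X" for x
  proof -
    define l where "l = (LEAST l. l < q \<and> x \<in> H (c l))"
    have "\<exists>l. l < q \<and> x \<in> H (c l)" using \<C>(3) c x by blast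
    then have "l < q \<and> x \<in> H (c l)" unfolding l_def by (rule LeastI_ex)
    moreover have "x \<notin> H (c l')" if "l' < l" for l'
      using not_less_Least that l_def calculation by fastforce
    ultimately show ?thesis by (auto simp: D_def)
  qed
  have Ddis: "l = l'" if "x \<in> D l" "x \<in> D l'" for x l l'
    using that linorder_neqE_nat[of l l'] unfolding D_def by blast
  \<comment> \<open>At a point of \<open>D l\<close> only the family chosen for the
    \<open>l\<close>-th component is visible.\<close>
  define W where "W i = (\<Union>l<q. D l \<inter> V (c l) i)" for i
  have "openin X (W i) \<and> W i \<subseteq> U i" if "i < m" for i
    using HVc Dop that by (fastforce simp: W_def shrinking_of_order_def)
  moreover have "x \<in> (\<Union>i<m. W i)" if x: "x \<in> topspace X" for x
  proof -
    obtain l where l: "l < q" "x \<in> D l" using Dcov x by blast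
    then have "x \<in> (\<Union>i<m. V (c l) i)" using HVc[of l] by (auto simp: D_def)
    then show ?thesis using l by (auto simp: W_def)
  qed
  moreover have "card {i. i < m \<and> x \<in> W i} \<le> n + 1" if x: "x \<in> topspace X" for x
  proof -
    obtain l where l: "l < q" "x \<in> D l" using Dcov x by blast
    have "{i. i < m \<and> x \<in> W i} \<subseteq> {i. i < m \<and> x \<in> V (c l) i}"
      using Ddis l by (auto simp: W_def)
    then have "card {i. i < m \<and> x \<in> W i} \<le> card {i. i < m \<and> x \<in> V (c l) i}"
      by (intro card_mono) auto
    also have "\<dots> \<le> n + 1" using HVc[OF l(1)] x by (simp add: shrinking_of_order_def)
    finally show ?thesis .
  qed
  ultimately show "\<exists>V. shrinking_of_order X (topspace X) n m U V"
    unfolding shrinking_of_order_def by blast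
qed

section \<open>Open stars of the Kuhn triangulation\<close>

text \<open>This is Lebesgue's covering lemma. \<open>Z\<close> is given without a metric; the
  coordinates supply one, which is continuous and, by injectivity, positive off the
  diagonal.\<close>

lemma uniform_shrinking_by_coordinates:
  fixes h :: "'a \<Rightarrow> 'j \<Rightarrow> real"
  assumes Z: "compact_space Z" and J: "finite J"
    and h: "\<And>j. j \<in> J \<Longrightarrow> continuous_map Z euclideanreal (\<lambda>x. h x j)"
    and inj: "\<And>x y. \<lbrakk>x \<in> topspace Z; y \<in> topspace Z; \<And>j. j \<in> J \<Longrightarrow> h x j = h y j\<rbrakk> \<Longrightarrow> x = y"
    and U: "\<And>U. U \<in> \<U> \<Longrightarrow> openin Z U" "topspace Z \<subseteq> \<Union>\<U>"
  shows "\<exists>\<delta>>0. \<forall>x\<in>topspace Z. \<exists>U\<in>\<U>. \<forall>y\<in>topspace Z.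
    (\<Sum>j\<in>J. \<bar>h x j - h y j\<bar>) < \<delta> \<longrightarrow> y \<in> U"
proof -
  define D where "D x y = (\<Sum>j\<in>J. \<bar>h x j - h y j\<bar>)" for x y
  have contD: "continuous_map Z euclideanreal (D x)" for x
    unfolding D_def by (intro continuous_intros J h)
  have D0: "x = y" if "x \<in> topspace Z" "y \<in> topspace Z" "D x y = 0" for x y
    using that inj[of x y] J unfolding D_def by (simp add: sum_nonneg_eq_0_iff)
  have Dnn: "D x y \<ge> 0" for x y by (simp add: D_def sum_nonneg)
  have tri: "D x z \<le> D x y + D y z" for x y z
    unfolding D_def sum.distrib[symmetric] by (intro sum_mono) auto
  have pt: "\<exists>\<delta>>0. \<forall>y\<in>topspace Z. D x y < \<delta> \<longrightarrow> y \<in> U" if x: "x \<in> U" "U \<in> \<U>" for x U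
  proof (cases "topspace Z - U = {}")
    case True
    then show ?thesis by (intro exI[of _ 1]) auto
  next
    case False
    have "compactin Z (topspace Z - U)" using Z U(1)[OF x(2)] by (intro closedin_compact_space) auto
    then have "compact (D x ` (topspace Z - U))" using image_compactin[OF _ contD] by force
    then obtain c where c: "c \<in> topspace Z - U" "\<And>y. y \<in> topspace Z - U \<Longrightarrow> D x c \<le> D x y"
      using compact_attains_inf[of "D x ` (topspace Z - U)"] False by auto
    have "x \<in> topspace Z" using U(1)[OF x(2)] x(1) openin_subset by blast
    then have "D x c \<noteq> 0" using D0[of x c] c(1) x(1) by auto
    then have "D x c > 0" using Dnn[of x c] by simp
    moreover have "\<forall>y\<in>topspace Z. D x y < D x c \<longrightarrow> y \<in> U" using c(2) by force
    ultimately show ?thesis by blast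
  qed
  have "\<forall>x\<in>topspace Z. \<exists>U \<delta>. U \<in> \<U> \<and> \<delta> > 0 \<and> (\<forall>y\<in>topspace Z. D x y < \<delta> \<longrightarrow> y \<in> U)"
  proof
    fix x assume "x \<in> topspace Z"
    then obtain U where "U \<in> \<U>" "x \<in> U" using U(2) by blast
    then show "\<exists>U \<delta>. U \<in> \<U> \<and> \<delta> > 0 \<and> (\<forall>y\<in>topspace Z. D x y < \<delta> \<longrightarrow> y \<in> U)"
      using pt[of x U] by blast
  qed
  then obtain U0 \<delta>0 where U0: "\<And>x. x \<in> topspace Z \<Longrightarrow>
      U0 x \<in> \<U> \<and> \<delta>0 x > 0 \<and> (\<forall>y\<in>topspace Z. D x y < \<delta>0 x \<longrightarrow> y \<in> U0 x)"
    by metis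
  \<comment> \<open>Half of the radius, so that the triangle inequality can pass from
    \<open>x\<close> to the centre of a ball that contains it.\<close>
  define B where "B x = {y \<in> topspace Z. D x y \<in> {..<\<delta>0 x / 2}}" for x
  have "openin Z (B x)" for x
    unfolding B_def by (rule openin_continuous_map_preimage[OF contD]) auto
  moreover have "topspace Z \<subseteq> \<Union>(B ` topspace Z)"
    using U0 by (auto simp: B_def D_def)
  ultimately obtain \<F> where \<F>: "finite \<F>" "\<F> \<subseteq> B ` topspace Z" "topspace Z \<subseteq> \<Union>\<F>"
    using Z unfolding compact_space_alt by (metis (mono_tags, lifting) imageE)
  then obtain P where P: "finite P" "P \<subseteq> topspace Z" "topspace Z \<subseteq> \<Union>(B ` P)"
    using finite_subset_image[OF \<F>(1,2)] by metis
  define \<delta> where "\<delta> = Min (insert 1 ((\<lambda>x. \<delta>0 x / 2) ` P))"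
  have "\<delta> > 0" using P U0 by (auto simp: \<delta>_def)
  moreover have "\<exists>U\<in>\<U>. \<forall>y\<in>topspace Z. D x y < \<delta> \<longrightarrow> y \<in> U" if x: "x \<in> topspace Z" for x
  proof -
    obtain p where p: "p \<in> P" "x \<in> B p" using P(3) x by blast
    have "\<delta> \<le> \<delta>0 p / 2" unfolding \<delta>_def using P(1) p(1) by (intro Min_le) auto
    then have "D p y < \<delta>0 p" if "D x y < \<delta>" for y
      using tri[of p y x] p(2) that by (auto simp: B_def)
    then show ?thesis using U0[of p] p(1) P(2) by blast
  qed
  ultimately show ?thesis unfolding D_def by blast
qed

text \<open>
  For \<open>\<theta> \<in> (0, 1)\<close> the vectors \<open>\<lfloor>x + \<theta>\<rfloor>\<close> run through the vertices of the simplex of the Kuhn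
  triangulation that contains \<open>x\<close>, so the sets in question are the open stars of its vertices.
\<close>

definition kuhn_star :: "'j set \<Rightarrow> ('j \<Rightarrow> int) \<Rightarrow> ('j \<Rightarrow> real) set" where
  "kuhn_star J v = {x. \<exists>\<theta>. 0 < \<theta> \<and> \<theta> < 1 \<and> (\<forall>j\<in>J. of_int (v j) < x j + \<theta> \<and> x j + \<theta> < of_int (v j) + 1)}"

text \<open>For each \<open>j\<close> there is at most one \<open>\<theta>\<close> in (0, 1) for
  which \<open>x j + \<theta>\<close> is an integer, namely
  \<open>\<lceil>x j\<rceil> - x j\<close>. Any \<open>\<theta>\<close> that avoids these finitely
  many values gives a star.\<close>

lemma kuhn_star_covers:
  assumes "finite J"
  obtains v where "v \<in> extensional J" "x \<in> kuhn_star J v"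
proof -
  have "finite ((\<lambda>j. of_int \<lceil>x j\<rceil> - x j) ` J)" using assms by simp
  then have "infinite ({0<..<1::real} - (\<lambda>j. of_int \<lceil>x j\<rceil> - x j) ` J)"
    using infinite_Ioo[of "0::real" 1] Diff_infinite_finite by simp
  then obtain \<theta> where "\<theta> \<in> {0<..<1::real} - (\<lambda>j. of_int \<lceil>x j\<rceil> - x j) ` J"
    using infinite_imp_nonempty by blast
  then have \<theta>: "0 < \<theta>" "\<theta> < 1" "\<And>j. j \<in> J \<Longrightarrow> \<theta> \<noteq> of_int \<lceil>x j\<rceil> - x j"
    by auto
  define v where "v = restrict (\<lambda>j. \<lfloor>x j + \<theta>\<rfloor>) J"
  have "of_int (v j) < x j + \<theta> \<and> x j + \<theta> < of_int (v j) + 1" if j: "j \<in> J" for j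
  proof -
    have "x j + \<theta> \<noteq> of_int \<lfloor>x j + \<theta>\<rfloor>"
    proof
      assume eq: "x j + \<theta> = of_int \<lfloor>x j + \<theta>\<rfloor>"
      then have "\<lceil>x j\<rceil> = \<lfloor>x j + \<theta>\<rfloor>"
        using \<theta>(1,2) by (intro ceiling_unique, simp_all)
      then show False using \<theta>(3)[OF j] eq by simp
    qed
    then show ?thesis using j by (simp add: v_def) linarith
  qed
  then have "x \<in> kuhn_star J v" using \<theta> by (auto simp: kuhn_star_def)
  then show ?thesis using that[of v] by (simp add: v_def)
qed

text \<open>Floors are monotone in \<open>\<theta>\<close>, so the vectors \<open>v\<close> form a
  chain, and a vector of a chain is determined by its coordinate sum. Measured from
  \<open>\<lfloor>x\<rfloor>\<close>, this sum is an integer between 0 and \<open>card J\<close>.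
  Extensionality makes vectors equal as soon as they agree on \<open>J\<close>.\<close>

lemma card_kuhn_stars_le:
  assumes J: "finite J"
  shows "finite {v \<in> extensional J. x \<in> kuhn_star J v} \<and>
    card {v \<in> extensional J. x \<in> kuhn_star J v} \<le> card J + 1"
proof -
  let ?T = "{v \<in> extensional J. x \<in> kuhn_star J v}"
  have "\<forall>v\<in>?T. \<exists>\<theta>. 0 < \<theta> \<and> \<theta> < 1 \<and> (\<forall>j\<in>J. v j = \<lfloor>x j + \<theta>\<rfloor>)"
  proof
    fix v assume "v \<in> ?T"
    then obtain \<theta> where "0 < \<theta>" "\<theta> < 1" and
      *: "\<And>j. j \<in> J \<Longrightarrow> of_int (v j) < x j + \<theta> \<and> x j + \<theta> < of_int (v j) + 1"
      by (auto simp: kuhn_star_def)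
    moreover have "v j = \<lfloor>x j + \<theta>\<rfloor>" if "j \<in> J" for j
      using *[OF that] by (intro floor_unique[symmetric]) auto
    ultimately show "\<exists>\<theta>. 0 < \<theta> \<and> \<theta> < 1 \<and> (\<forall>j\<in>J. v j = \<lfloor>x j + \<theta>\<rfloor>)" by blast
  qed
  then obtain \<theta> where \<theta>: "\<And>v. v \<in> ?T \<Longrightarrow> 0 < \<theta> v \<and> \<theta> v < 1 \<and> (\<forall>j\<in>J. v j = \<lfloor>x j + \<theta> v\<rfloor>)"
    by metis
  define s where "s v = (\<Sum>j\<in>J. v j - \<lfloor>x j\<rfloor>)" for v
  have le: "v = w" if "v \<in> ?T" "w \<in> ?T" "s v = s w" "\<theta> v \<le> \<theta> w" for v w
  proof -
    have mono: "v j \<le> w j" if "j \<in> J" for j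
      using \<theta>[OF \<open>v \<in> ?T\<close>] \<theta>[OF \<open>w \<in> ?T\<close>] that \<open>\<theta> v \<le> \<theta> w\<close> by (auto intro: floor_mono)
    have "(\<Sum>j\<in>J. w j - v j) = 0"
      using \<open>s v = s w\<close> by (simp add: s_def sum_subtractf)
    then have "\<forall>j\<in>J. w j - v j = 0"
      using J mono by (subst (asm) sum_nonneg_eq_0_iff) auto
    then show "v = w"
      using \<open>v \<in> ?T\<close> \<open>w \<in> ?T\<close> by (intro extensionalityI[of _ J]) auto
  qed
  have inj: "inj_on s ?T"
  proof (rule inj_onI)
    fix v w assume "v \<in> ?T" "w \<in> ?T" "s v = s w"
    then show "v = w" using le[of v w] le[of w v] linear[of "\<theta> v" "\<theta> w"] by auto
  qed
  have sub: "s ` ?T \<subseteq> {0..int (card J)}"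
  proof
    fix z assume "z \<in> s ` ?T"
    then obtain v where v: "v \<in> ?T" "z = s v" by blast
    have b: "0 \<le> v j - \<lfloor>x j\<rfloor> \<and> v j - \<lfloor>x j\<rfloor> \<le> 1" if "j \<in> J" for j
    proof -
      have "v j = \<lfloor>x j + \<theta> v\<rfloor>" "0 < \<theta> v" "\<theta> v < 1" using \<theta>[OF v(1)] that by auto
      then show ?thesis by linarith
    qed
    have "0 \<le> s v" unfolding s_def using b by (intro sum_nonneg) auto
    moreover have "s v \<le> (\<Sum>j\<in>J. 1)" unfolding s_def using b by (intro sum_mono) auto
    ultimately show "z \<in> {0..int (card J)}" using v(2) by simp
  qed
  show ?thesis
    using inj_on_finite[OF inj sub] card_inj_on_le[OF inj sub] by simp
qed

text \<open>The coordinates embed \<open>Z\<close> in a Euclidean space of dimension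
  \<open>card J\<close>, and the preimages of the open stars of a fine Kuhn triangulation form a
  fine cover with at most \<open>card J + 1\<close> members at any point.\<close>

lemma covering_dim_le_injective_coordinates:
  fixes h :: "'a \<Rightarrow> 'j \<Rightarrow> real"
  assumes Z: "compact_space Z" and J: "finite J" "card J \<le> n"
    and h: "\<And>j. j \<in> J \<Longrightarrow> continuous_map Z euclideanreal (\<lambda>x. h x j)"
    and inj: "\<And>x y. \<lbrakk>x \<in> topspace Z; y \<in> topspace Z; \<And>j. j \<in> J \<Longrightarrow> h x j = h y j\<rbrakk> \<Longrightarrow> x = y"
  shows "covering_dim_le Z n"
  unfolding covering_dim_le_def
proof (intro allI impI)
  fix \<U> assume \<U>: "open_cover_of Z \<U> \<and> finite \<U>"
  have cov: "\<And>U. U \<in> \<U> \<Longrightarrow> openin Z U" "topspace Z \<subseteq> \<Union>\<U>"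
    using \<U> by (auto simp: open_cover_of_def)
  have "\<exists>\<delta>>0. \<forall>x\<in>topspace Z. \<exists>U\<in>\<U>. \<forall>y\<in>topspace Z.
      (\<Sum>j\<in>J. \<bar>h x j - h y j\<bar>) < \<delta> \<longrightarrow> y \<in> U"
    by (rule uniform_shrinking_by_coordinates[OF Z J(1)], (fact h inj cov)+)
  then obtain \<delta> where \<delta>: "\<delta> > 0"
    "\<And>x. x \<in> topspace Z \<Longrightarrow> \<exists>U\<in>\<U>. \<forall>y\<in>topspace Z. (\<Sum>j\<in>J. \<bar>h x j - h y j\<bar>) < \<delta> \<longrightarrow> y \<in> U"
    by blast
  \<comment> \<open>After scaling by \<open>N\<close>, a star has diameter at most
    \<open>2 * card J / N\<close> in the sum distance, and this is less than
    \<open>\<delta>\<close>. The summand 1 makes the inequality strict and keeps \<open>N\<close>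
    positive when \<open>J\<close> is empty.\<close>
  define N where "N = 2 * (real (card J) + 1) / \<delta>"
  have N: "N > 0" "2 * real (card J) / N < \<delta>" using \<delta>(1) by (auto simp: N_def field_simps)
  define W where "W v = {x \<in> topspace Z. (\<lambda>j. N * h x j) \<in> kuhn_star J v}" for v
  have Wop: "openin Z (W v)" for v
  proof -
    have Weq: "W v = (\<Union>\<theta>\<in>{0<..<1}. {x \<in> topspace Z. \<forall>j\<in>J. N * h x j + \<theta> \<in> {of_int (v j)<..<of_int (v j) + 1}})"
      by (auto simp: W_def kuhn_star_def)
    have "openin Z {x \<in> topspace Z. \<forall>j\<in>J. N * h x j + \<theta> \<in> {of_int (v j)<..<of_int (v j) + 1}}" for \<theta>
    proof -
      have "openin Z {x \<in> topspace Z. N * h x j + \<theta> \<in> {of_int (v j)<..<of_int (v j) + 1}}" if "j \<in> J" for j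
        using h[OF that] by (intro openin_continuous_map_preimage[where Y=euclideanreal] continuous_intros) auto
      then have "openin Z (topspace Z \<inter> (\<Inter>j\<in>J. {x \<in> topspace Z. N * h x j + \<theta> \<in> {of_int (v j)<..<of_int (v j) + 1}}))"
        using J(1) by (cases "J = {}") (auto intro!: openin_Int openin_INT2)
      moreover have "topspace Z \<inter> (\<Inter>j\<in>J. {x \<in> topspace Z. N * h x j + \<theta> \<in> {of_int (v j)<..<of_int (v j) + 1}})
          = {x \<in> topspace Z. \<forall>j\<in>J. N * h x j + \<theta> \<in> {of_int (v j)<..<of_int (v j) + 1}}"
        by auto
      ultimately show ?thesis by simp
    qed
    then show ?thesis unfolding Weq by (intro openin_Union) auto
  qed
  have small: "\<exists>U\<in>\<U>. W v \<subseteq> U" if "x \<in> W v" for x v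
  proof -
    have close: "(\<Sum>j\<in>J. \<bar>h x j - h y j\<bar>) < \<delta>" if y: "y \<in> W v" for y
    proof -
      have "\<bar>h x j - h y j\<bar> \<le> 2 / N" if "j \<in> J" for j
      proof -
        have *: "\<exists>\<theta>. 0 < \<theta> \<and> \<theta> < 1 \<and> of_int (v j) < N * h z j + \<theta> \<and> N * h z j + \<theta> < of_int (v j) + 1"
          if "z \<in> W v" for z
          using that \<open>j \<in> J\<close> by (auto simp: W_def kuhn_star_def)
        \<comment> \<open>Both shifted values lie in the same unit interval, and the two shifts
          differ by less than 1.\<close>
        have "\<bar>N * h x j - N * h y j\<bar> \<le> 2"
          using *[OF \<open>x \<in> W v\<close>] *[OF y] by (elim exE) linarith
        then have "N * \<bar>h x j - h y j\<bar> \<le> 2" using N(1)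
          by (metis abs_mult abs_of_pos right_diff_distrib)
        then show ?thesis using N(1) by (simp add: field_simps)
      qed
      then have "(\<Sum>j\<in>J. \<bar>h x j - h y j\<bar>) \<le> (\<Sum>j\<in>J. 2 / N)" by (intro sum_mono) auto
      also have "\<dots> < \<delta>" using N(2) by (simp add: mult.commute)
      finally show ?thesis .
    qed
    have "x \<in> topspace Z" using that by (simp add: W_def)
    then obtain U where "U \<in> \<U>" "\<forall>y\<in>topspace Z. (\<Sum>j\<in>J. \<bar>h x j - h y j\<bar>) < \<delta> \<longrightarrow> y \<in> U"
      using \<delta>(2) by blast
    then show ?thesis using close by (intro bexI[of _ U]) (auto simp: W_def)
  qed
  define E where "E = {v \<in> extensional J. W v \<noteq> {}}"
  have "\<forall>v\<in>E. \<exists>U\<in>\<U>. W v \<subseteq> U" using small by (auto simp: E_def)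
  then obtain g where g: "\<And>v. v \<in> E \<Longrightarrow> g v \<in> \<U> \<and> W v \<subseteq> g v" by metis
  \<comment> \<open>Stars are merged according to the member of the given cover that contains them.
    This makes the refinement finite without bounding the set of grid points, and it cannot raise
    the order.\<close>
  define V where "V U = (\<Union>v\<in>{v\<in>E. g v = U}. W v)" for U
  have "\<forall>x\<in>topspace Z. card {V' \<in> V ` \<U>. x \<in> V'} \<le> n + 1"
  proof
    fix x
    let ?T = "{v \<in> extensional J. (\<lambda>j. N * h x j) \<in> kuhn_star J v}"
    have "{V' \<in> V ` \<U>. x \<in> V'} \<subseteq> (\<lambda>v. V (g v)) ` ?T"
      by (auto simp: V_def E_def W_def)
    then have "card {V' \<in> V ` \<U>. x \<in> V'} \<le> card ((\<lambda>v. V (g v)) ` ?T)"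
      using card_kuhn_stars_le[OF J(1), of "\<lambda>j. N * h x j"] by (intro card_mono) auto
    also have "\<dots> \<le> card ?T"
      using card_kuhn_stars_le[OF J(1), of "\<lambda>j. N * h x j"] by (intro card_image_le) auto
    finally show "card {V' \<in> V ` \<U>. x \<in> V'} \<le> n + 1" using card_kuhn_stars_le[OF J(1), of "\<lambda>j. N * h x j"] J(2) by linarith
  qed
  moreover have "open_cover_of Z (V ` \<U>)"
  proof -
    have "x \<in> \<Union>(V ` \<U>)" if x: "x \<in> topspace Z" for x
    proof -
      obtain v where "v \<in> extensional J" "x \<in> W v"
        using kuhn_star_covers[OF J(1), of "\<lambda>j. N * h x j"] x unfolding W_def by blast
      then have "v \<in> E" by (auto simp: E_def)
      then have "x \<in> V (g v)" "g v \<in> \<U>" using \<open>x \<in> W v\<close> g by (auto simp: V_def)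
      then show ?thesis by blast
    qed
    moreover have "\<Union>(V ` \<U>) \<subseteq> topspace Z" by (auto simp: V_def W_def)
    moreover have "openin Z (V U)" for U unfolding V_def using Wop by auto
    ultimately show ?thesis by (auto simp: open_cover_of_def)
  qed
  moreover have "\<forall>V'\<in>V ` \<U>. \<exists>U\<in>\<U>. V' \<subseteq> U"
  proof -
    have "V U \<subseteq> U" for U using g by (auto simp: V_def)
    then show ?thesis by blast
  qed
  moreover have "finite (V ` \<U>)" using \<U> by blast
  ultimately have "open_cover_of Z (V ` \<U>) \<and> finite (V ` \<U>) \<and> (\<forall>V'\<in>V ` \<U>. \<exists>U\<in>\<U>. V' \<subseteq> U) \<and>
      (\<forall>x\<in>topspace Z. card {V' \<in> V ` \<U>. x \<in> V'} \<le> n + 1)" by (intro conjI)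
  then show "\<exists>\<V>. open_cover_of Z \<V> \<and> finite \<V> \<and>
      (\<forall>V\<in>\<V>. \<exists>U\<in>\<U>. V \<subseteq> U) \<and> (\<forall>x\<in>topspace Z. card {V \<in> \<V>. x \<in> V} \<le> n + 1)"
    by (rule exI)
qed

section \<open>The thick part of a map\<close>

text \<open>Otherwise \<open>A \<union> B\<close> would be a continuum decomposed into two proper
  subcontinua. Being connected, it lies in one component of \<open>X\<close>, where hereditary
  indecomposability forbids this.\<close>

lemma Bing_compactum_subcontinua_nested:
  assumes X: "Bing_compactum X"
    and A: "compactin X A" "connectedin X A" and B: "compactin X B" "connectedin X B"
    and meet: "A \<inter> B \<noteq> {}"
  shows "A \<subseteq> B \<or> B \<subseteq> A"
proof (rule ccontr)
  assume neg: "\<not> (A \<subseteq> B \<or> B \<subseteq> A)"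
  obtain x where x: "x \<in> A" "x \<in> B" using meet by blast
  define C where "C = connected_component_of_set X x"
  have "x \<in> topspace X" using A(1) x compactin_subset_topspace by blast
  then have C: "C \<in> connected_components_of X"
    by (simp add: C_def connected_component_in_connected_components_of)
  have sub: "A \<subseteq> C" "B \<subseteq> C"
    using A(2) B(2) x by (simp_all add: C_def connected_component_of_maximal)
  have "subcontinuum_in (subtopology X C) A" "subcontinuum_in (subtopology X C) B"
    "subcontinuum_in (subtopology X C) (A \<union> B)"
    using A B sub x connectedin_Un[OF A(2) B(2) meet] compactin_Un[OF A(1) B(1)]
    by (auto simp: subcontinuum_in_def compactin_subtopology connectedin_subtopology)
  moreover have "A \<subset> A \<union> B" "B \<subset> A \<union> B" using neg by auto
  moreover have "hereditarily_indecomposable (subtopology X C)"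
    using X C by (simp add: Bing_compactum_def)
  ultimately show False unfolding hereditarily_indecomposable_def by blast
qed

text \<open>A map from a compact space to a Hausdorff space is closed, and \<open>U\<close> is the
  complement of the image of the closed set outside \<open>G\<close>.\<close>

lemma fibre_tube:
  assumes X: "compact_space X" and Y: "Hausdorff_space Y" and f: "continuous_map X Y f"
    and y: "y \<in> topspace Y" and G: "openin X G" "{x \<in> topspace X. f x = y} \<subseteq> G"
  obtains U where "openin Y U" "y \<in> U" "{x \<in> topspace X. f x \<in> U} \<subseteq> G"
proof -
  have "compactin X (topspace X - G)" using X G(1) by (intro closedin_compact_space) auto
  then have "closedin Y (f ` (topspace X - G))"
    using image_compactin[OF _ f] compactin_imp_closedin[OF Y] by blast
  then have "openin Y (topspace Y - f ` (topspace X - G))" by auto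
  moreover have "y \<in> topspace Y - f ` (topspace X - G)" using y G(2) by auto
  moreover have "{x \<in> topspace X. f x \<in> topspace Y - f ` (topspace X - G)} \<subseteq> G" by auto
  ultimately show ?thesis using that by blast
qed

section \<open>Thin and thick points\<close>

text \<open>\<open>V\<close> is a clopen piece of the preimage of \<open>U\<close> inside one member
  of \<open>\<omega>\<close>. For maps of compacta this amounts to the component of the fibre
  through \<open>x\<close> lying in such a member. The form over a whole neighbourhood makes
  thinness an open condition and supplies the pieces of the later partitions.\<close>

definition thin_at :: "'a topology \<Rightarrow> 'b topology \<Rightarrow> ('a \<Rightarrow> 'b) \<Rightarrow> 'a set set \<Rightarrow> 'a \<Rightarrow> bool" where
  "thin_at X Y f \<omega> x \<longleftrightarrow>
     (\<exists>U V. openin Y U \<and> openin X V \<and> openin X ({z \<in> topspace X. f z \<in> U} - V) \<and>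
        x \<in> V \<and> f ` V \<subseteq> U \<and> (\<exists>W\<in>\<omega>. V \<subseteq> W))"

definition thick_part :: "'a topology \<Rightarrow> 'b topology \<Rightarrow> ('a \<Rightarrow> 'b) \<Rightarrow> 'a set set \<Rightarrow> 'a set" where
  "thick_part X Y f \<omega> = {x \<in> topspace X. \<not> thin_at X Y f \<omega> x}"

text \<open>The witnesses \<open>U\<close> and \<open>V\<close> of one thin point serve every point
  of \<open>V\<close>.\<close>

lemma closedin_thick_part: "closedin X (thick_part X Y f \<omega>)"
proof -
  have "\<exists>V. openin X V \<and> x \<in> V \<and> V \<subseteq> topspace X - thick_part X Y f \<omega>"
    if "x \<in> topspace X - thick_part X Y f \<omega>" for x
  proof -
    have "thin_at X Y f \<omega> x" using that by (auto simp: thick_part_def)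
    then obtain U V where UV: "openin Y U" "openin X V" "openin X ({z \<in> topspace X. f z \<in> U} - V)"
        "x \<in> V" "f ` V \<subseteq> U" "\<exists>W\<in>\<omega>. V \<subseteq> W"
      unfolding thin_at_def by blast
    then have "thin_at X Y f \<omega> z" if "z \<in> V" for z using that unfolding thin_at_def by blast
    then have "V \<subseteq> topspace X - thick_part X Y f \<omega>"
      using openin_subset[OF UV(2)] by (auto simp: thick_part_def)
    then show ?thesis using UV by blast
  qed
  then have "openin X (topspace X - thick_part X Y f \<omega>)"
    by (subst openin_subopen) blast
  then show ?thesis by (auto simp: closedin_def thick_part_def)
qed

text \<open>If the component lay in \<open>W\<close>, so would a clopen part \<open>H\<close> of the
  fibre around it. Disjoint open sets around \<open>H\<close> and around the rest of the fibre still
  split all nearby fibres, which would make the point thin.\<close>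

lemma fibre_component_of_thick_point_not_small:
  assumes X: "compactum X" and Y: "compactum Y" and f: "continuous_map X Y f"
    and \<omega>: "open_cover_of X \<omega>" and x: "x \<in> thick_part X Y f \<omega>" and W: "W \<in> \<omega>"
  shows "\<not> connected_component_of_set (subtopology X {z \<in> topspace X. f z = f x}) x \<subseteq> W"
proof
  let ?F = "{z \<in> topspace X. f z = f x}"
  let ?C = "connected_component_of_set (subtopology X ?F) x"
  assume CW: "?C \<subseteq> W"
  have cX: "compact_space X" "Hausdorff_space X" "normal_space X" and HY: "Hausdorff_space Y"
    using X Y metrizable_imp_Hausdorff_space metrizable_imp_normal_space by (auto simp: compactum_def)
  have xX: "x \<in> topspace X" using x by (simp add: thick_part_def)
  then have fx: "f x \<in> topspace Y" using f by (auto simp: continuous_map_def)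
  then have "closedin Y {f x}" using HY by (simp add: closedin_Hausdorff_singleton)
  then have clF: "closedin X ?F"
    using closedin_continuous_map_preimage[OF f, of "{f x}"] by simp
  have cF: "compact_space (subtopology X ?F)"
    using clF cX(1) closedin_compact_space compact_space_subtopology by blast
  have hF: "Hausdorff_space (subtopology X ?F)" using cX(2) Hausdorff_space_subtopology by blast
  have WX: "openin X W" using \<omega> W by (simp add: open_cover_of_def)
  have C: "?C \<in> connected_components_of (subtopology X ?F)"
    using xX by (simp add: connected_component_in_connected_components_of)
  have "openin (subtopology X ?F) (W \<inter> ?F)" using WX by (auto simp: openin_subtopology)
  moreover have "?C \<subseteq> W \<inter> ?F"
    using CW connected_components_of_subset[OF C] by auto
  ultimately obtain H where H: "openin (subtopology X ?F) H" "closedin (subtopology X ?F) H"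
      "?C \<subseteq> H" "H \<subseteq> W \<inter> ?F"
    using clopen_neighbourhood_of_component[OF cF hF C] by blast
  have clH: "closedin X H" using H(2) clF closedin_trans_full by blast
  have "closedin (subtopology X ?F) (?F - H)"
    using H(1) by (metis (no_types, lifting) clF closedin_diff closedin_subset closedin_topspace topspace_subtopology_subset)
  then have clH': "closedin X (?F - H)" using clF closedin_trans_full by blast
  have "disjnt H (?F - H)" by (auto simp: disjnt_def)
  then obtain P Q where PQ: "openin X P" "openin X Q" "H \<subseteq> P" "?F - H \<subseteq> Q" "disjnt P Q"
    using cX(3)[unfolded normal_space_def, rule_format, of H "?F - H"] clH clH' by blast
  have "openin X ((P \<inter> W) \<union> Q)" using PQ WX by auto
  moreover have "?F \<subseteq> (P \<inter> W) \<union> Q" using PQ H(4) by auto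
  ultimately obtain U where U: "openin Y U" "f x \<in> U" "{z \<in> topspace X. f z \<in> U} \<subseteq> (P \<inter> W) \<union> Q"
    using fibre_tube[OF cX(1) HY f fx] by blast
  \<comment> \<open>Over \<open>U\<close> the space lies in \<open>P \<inter> W\<close> and
    \<open>Q\<close>. These are disjoint, so what \<open>V\<close> leaves of the preimage is its
    part in \<open>Q\<close>, an open set.\<close>
  define V where "V = {z \<in> P \<inter> W. f z \<in> U}"
  have "openin X V" unfolding V_def using PQ WX U f by (intro openin_continuous_map_preimage_gen) auto
  moreover have "{z \<in> topspace X. f z \<in> U} - V = {z \<in> Q. f z \<in> U}"
    using U(3) PQ(5) openin_subset[OF PQ(2)] by (auto simp: V_def disjnt_iff)
  then have "openin X ({z \<in> topspace X. f z \<in> U} - V)"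
    using openin_continuous_map_preimage_gen[OF f PQ(2) U(1)] by simp
  moreover have "x \<in> ?C" using xX by (simp add: connected_component_of_refl)
  then have "x \<in> V" using H(3,4) PQ(3) U(2) by (auto simp: V_def)
  moreover have "f ` V \<subseteq> U" "V \<subseteq> W" by (auto simp: V_def)
  ultimately have "thin_at X Y f \<omega> x" unfolding thin_at_def using U(1) W by blast
  then show False using x by (simp add: thick_part_def)
qed

text \<open>Nestedness says something about connected sets only, so the dimension is built up from
  them: from closed subsets of fibres to compact pieces through their components, and from there to
  a finite union of closed pieces.\<close>

lemma covering_dim_le_thick_part:
  assumes X: "Bing_compactum X" and Y: "compactum Y" and f: "dimensional_map k X Y f"
    and \<omega>: "open_cover_of X \<omega>"
  shows "covering_dim_le (subtopology X (thick_part X Y f \<omega>)) k"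
proof -
  let ?B = "thick_part X Y f \<omega>"
  have cX: "compactum X" using X by (simp add: Bing_compactum_def)
  then have c: "compact_space X" "metrizable_space X" by (auto simp: compactum_def)
  have cont: "continuous_map X Y f" using f by (simp add: dimensional_map_def)
  have clB: "closedin X ?B" by (rule closedin_thick_part)
  then have BX: "?B \<subseteq> topspace X" by (rule closedin_subset)
  have compB: "compactin X ?B" using c(1) clB by (rule closedin_compact_space)
  have HY: "Hausdorff_space Y" using Y metrizable_imp_Hausdorff_space by (auto simp: compactum_def)
  have piece: "covering_dim_le (subtopology X (N \<inter> ?B)) k"
    if N: "closedin X N" "N \<subseteq> W" "W \<in> \<omega>" for N W
  proof (rule covering_dim_le_components)
    have clNB: "closedin X (N \<inter> ?B)" using N(1) clB by blast
    then show "compact_space (subtopology X (N \<inter> ?B))"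
      using c(1) closedin_compact_space compact_space_subtopology by blast
    show "metrizable_space (subtopology X (N \<inter> ?B))" using c(2) metrizable_space_subtopology by blast
    fix e assume e: "e \<in> connected_components_of (subtopology X (N \<inter> ?B))"
    have eNB: "e \<subseteq> N \<inter> ?B" using connected_components_of_subset[OF e] by auto
    have cle: "closedin X e"
      using closedin_connected_components_of[OF e] clNB closedin_trans_full by blast
    have con_e: "connectedin X e"
      using connectedin_connected_components_of[OF e] by (simp add: connectedin_subtopology)
    obtain x where x: "x \<in> e" using nonempty_connected_components_of[OF e] by blast
    let ?F = "{z \<in> topspace X. f z = f x}"
    let ?C = "connected_component_of_set (subtopology X ?F) x"
    have xB: "x \<in> ?B" and xX: "x \<in> topspace X" using x eNB BX by auto
    have fx: "f x \<in> topspace Y" using xX cont by (auto simp: continuous_map_def)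
    then have "closedin Y {f x}" using HY by (simp add: closedin_Hausdorff_singleton)
    then have clF: "closedin X ?F"
      using closedin_continuous_map_preimage[OF cont, of "{f x}"] by simp
    have C: "?C \<in> connected_components_of (subtopology X ?F)"
      using xX by (simp add: connected_component_in_connected_components_of)
    have clC: "closedin X ?C"
      using closedin_connected_components_of[OF C] clF closedin_trans_full by blast
    have con_C: "connectedin X ?C"
      using connectedin_connected_components_of[OF C] by (simp add: connectedin_subtopology)
    have xC: "x \<in> ?C" using xX by (simp add: connected_component_of_refl)
    \<comment> \<open>\<open>e\<close> lies in the member \<open>W\<close> and the fibre component
      does not, so of the two inclusions that nestedness allows only \<open>e \<subseteq> ?C\<close>
      remains.\<close>
    have "\<not> ?C \<subseteq> e"
      using fibre_component_of_thick_point_not_small[OF cX Y cont \<omega> xB N(3)] eNB N(2) by blast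
    moreover have "e \<subseteq> ?C \<or> ?C \<subseteq> e"
      using Bing_compactum_subcontinua_nested[OF X _ con_e _ con_C]
        closedin_compact_space[OF c(1) cle] closedin_compact_space[OF c(1) clC] x xC by blast
    ultimately have "e \<subseteq> ?F" using connected_components_of_subset[OF C] by auto
    moreover have "covering_dim_le (subtopology X ?F) k"
      using f fx by (auto simp: dimensional_map_def)
    moreover have "closedin (subtopology X ?F) e"
      using cle \<open>e \<subseteq> ?F\<close> by (rule closedin_subset_topspace)
    ultimately have "covering_dim_le (subtopology X e) k"
      using covering_dim_le_closed_subspace[of "subtopology X ?F" k e]
      by (simp add: subtopology_subtopology inf_absorb2)
    then show "covering_dim_le (subtopology (subtopology X (N \<inter> ?B)) e) k"
      using eNB by (simp add: subtopology_subtopology inf_absorb2)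
  qed
  have "\<exists>G N. openin X G \<and> closedin X N \<and> x \<in> G \<and> G \<subseteq> N \<and> (\<exists>W\<in>\<omega>. N \<subseteq> W)" if x: "x \<in> ?B" for x
  proof -
    have "x \<in> \<Union>\<omega>" using \<omega> x BX by (auto simp: open_cover_of_def)
    then obtain W where W: "W \<in> \<omega>" "x \<in> W" by blast
    have "neighbourhood_base_of (closedin X) X"
      using c(2) metrizable_imp_regular_space neighbourhood_base_of_closedin by blast
    moreover have "openin X W" using W \<omega> by (simp add: open_cover_of_def)
    ultimately obtain G N where "openin X G" "closedin X N" "x \<in> G" "G \<subseteq> N" "N \<subseteq> W"
      unfolding neighbourhood_base_of using W(2) by metis
    then show ?thesis using W(1) by blast
  qed
  then obtain G N where GN: "\<And>x. x \<in> ?B \<Longrightarrow> openin X (G x) \<and> closedin X (N x) \<and> x \<in> G x \<and>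
      G x \<subseteq> N x \<and> (\<exists>W\<in>\<omega>. N x \<subseteq> W)"
    by metis
  have op: "\<And>T. T \<in> G ` ?B \<Longrightarrow> openin X T" using GN by blast
  have "?B \<subseteq> \<Union>(G ` ?B)" using GN by blast
  then obtain \<F> where \<F>: "finite \<F>" "\<F> \<subseteq> G ` ?B" "?B \<subseteq> \<Union>\<F>"
    using compactinD[OF compB op] by metis
  then obtain P where P: "finite P" "P \<subseteq> ?B" "?B \<subseteq> \<Union>(G ` P)"
    using finite_subset_image[OF \<F>(1,2)] by metis
  obtain p and q :: nat where p: "P = p ` {..<q}"
    using P(1) by (metis finite_imp_nat_seg_image_inj_on lessThan_def)
  have pB: "p l \<in> ?B" if "l < q" for l using p P(2) that by blast
  show ?thesis
  proof (rule covering_dim_le_finite_closed_Union)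
    show "closedin (subtopology X ?B) (N (p l) \<inter> ?B)" if "l < q" for l
      using GN[OF pB[OF that]] by (auto simp: closedin_subtopology)
    show "covering_dim_le (subtopology (subtopology X ?B) (N (p l) \<inter> ?B)) k" if l: "l < q" for l
    proof -
      obtain W where "closedin X (N (p l))" "N (p l) \<subseteq> W" "W \<in> \<omega>"
        using GN[OF pB[OF l]] by blast
      then have "covering_dim_le (subtopology X (N (p l) \<inter> ?B)) k" by (rule piece)
      then show ?thesis by (simp add: subtopology_subtopology Int_commute Int_left_commute)
    qed
    show "topspace (subtopology X ?B) \<subseteq> (\<Union>l<q. N (p l) \<inter> ?B)"
    proof
      fix x assume "x \<in> topspace (subtopology X ?B)"
      then have xB: "x \<in> ?B" by simp
      then obtain l where "l < q" "x \<in> G (p l)" using P(3) p by blast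
      then show "x \<in> (\<Union>l<q. N (p l) \<inter> ?B)" using GN[OF pB] xB by blast
    qed
  qed
qed

section \<open>Partitions over small open sets\<close>

text \<open>The functions are left without normalization because \<open>A\<close> need not be the
  whole space: their sum is positive on \<open>A\<close>, hence on an open set around it, and
  division is possible there.\<close>

lemma bump_functions:
  assumes X: "completely_regular_space X" and A: "compactin X A"
    and U: "\<And>i. i < m \<Longrightarrow> openin X (U i)" "A \<subseteq> (\<Union>i<m. U i)"
  obtains \<phi> :: "nat \<Rightarrow> 'a \<Rightarrow> real" where
    "\<And>i. continuous_map X euclideanreal (\<phi> i)"
    "\<And>i x. x \<in> topspace X \<Longrightarrow> 0 \<le> \<phi> i x"
    "\<And>i x. \<lbrakk>i < m; x \<in> topspace X; x \<notin> U i\<rbrakk> \<Longrightarrow> \<phi> i x = 0"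
    "\<And>x. x \<in> A \<Longrightarrow> 0 < (\<Sum>i<m. \<phi> i x)"
proof -
  have AX: "A \<subseteq> topspace X" using A compactin_subset_topspace by blast
  have "\<exists>i h. i < m \<and> continuous_map X euclideanreal h \<and> (\<forall>z\<in>topspace X. 0 \<le> h z) \<and> h x > (0::real) \<and>
      (\<forall>z\<in>topspace X - U i. h z = 0)" if x: "x \<in> A" for x
  proof -
    obtain i where i: "i < m" "x \<in> U i" using U(2) x by blast
    have "closedin X (topspace X - U i)" "x \<in> topspace X - (topspace X - U i)"
      using U(1)[OF i(1)] i(2) x AX by auto
    then obtain g :: "'a \<Rightarrow> real" where g: "continuous_map X (top_of_set {0..1}) g" "g x = 0"
        "g ` (topspace X - U i) \<subseteq> {1}"
      using X unfolding completely_regular_space_def by metis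
    have "continuous_map X euclideanreal g" "\<And>z. z \<in> topspace X \<Longrightarrow> g z \<le> 1"
      using g(1) by (auto simp: continuous_map_in_subtopology)
    then have "continuous_map X euclideanreal (\<lambda>z. 1 - g z) \<and> (\<forall>z\<in>topspace X. 0 \<le> 1 - g z) \<and>
        1 - g x > 0 \<and> (\<forall>z\<in>topspace X - U i. 1 - g z = 0)"
      using g(2,3) by (auto intro!: continuous_intros)
    then show ?thesis using i(1) by (intro exI[of _ i] exI[of _ "\<lambda>z. 1 - g z"]) blast
  qed
  then obtain i0 h where ih: "\<And>x. x \<in> A \<Longrightarrow> i0 x < m \<and> continuous_map X euclideanreal (h x) \<and>
      (\<forall>z\<in>topspace X. 0 \<le> h x z) \<and> h x x > (0::real) \<and> (\<forall>z\<in>topspace X - U (i0 x). h x z = 0)"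
    by metis
  define B where "B x = {z \<in> topspace X. h x z \<in> {0<..}}" for x
  have "openin X (B x)" if "x \<in> A" for x
    unfolding B_def using ih[OF that] by (intro openin_continuous_map_preimage[where Y = euclideanreal]) auto
  then have "openin X T" if "T \<in> B ` A" for T
    using that by blast
  moreover have "A \<subseteq> \<Union>(B ` A)" using ih AX by (auto simp: B_def)
  ultimately obtain \<F> where \<F>: "finite \<F>" "\<F> \<subseteq> B ` A" "A \<subseteq> \<Union>\<F>"
    using compactinD[OF A] by metis
  then obtain P where P: "finite P" "P \<subseteq> A" "A \<subseteq> \<Union>(B ` P)"
    using finite_subset_image[OF \<F>(1,2)] by metis
  \<comment> \<open>Bumps subordinate to the same \<open>U i\<close> are added up; an index that
    received none gets the function 0.\<close>
  define \<phi> where "\<phi> i z = (\<Sum>x\<in>{x\<in>P. i0 x = i}. h x z)" for i z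
  show ?thesis
  proof (rule that[of \<phi>])
    show "continuous_map X euclideanreal (\<phi> i)" for i
      unfolding \<phi>_def using P ih by (intro continuous_map_sum) auto
    show "0 \<le> \<phi> i z" if "z \<in> topspace X" for i z
      unfolding \<phi>_def using P ih that by (intro sum_nonneg) auto
    show "\<phi> i z = 0" if "i < m" "z \<in> topspace X" "z \<notin> U i" for i z
      unfolding \<phi>_def using P ih that by (intro sum.neutral) auto
    show "0 < (\<Sum>i<m. \<phi> i z)" if z: "z \<in> A" for z
    proof -
      have group: "(\<Sum>i<m. \<phi> i z) = (\<Sum>x\<in>P. h x z)"
        unfolding \<phi>_def using P ih by (intro sum.group) auto
      obtain x where "x \<in> P" "h x z > 0" using P(3) z by (auto simp: B_def)
      moreover have "0 \<le> h x z" if "x \<in> P" for x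
        using that P(2) ih z AX by blast
      ultimately have "(\<Sum>x\<in>P. h x z) > 0"
        using P(1) by (intro sum_pos2[of P x]) auto
      then show ?thesis by (simp add: group)
    qed
  qed
qed

text \<open>\<open>V\<close> is clopen in \<open>P\<close> but may accumulate at points outside
  \<open>P\<close>. There \<open>\<phi>\<close> vanishes and, as a bound for \<open>g\<close>,
  forces its values to tend to 0.\<close>

lemma continuous_map_extend_by_zero:
  fixes g \<phi> :: "'a \<Rightarrow> real"
  assumes \<phi>: "continuous_map X euclideanreal \<phi>" and V: "openin X V" "openin X (P - V)"
    and zero: "\<And>x. \<lbrakk>x \<in> topspace X; x \<notin> P\<rbrakk> \<Longrightarrow> \<phi> x = 0"
    and g: "continuous_map (subtopology X V) euclideanreal g"
    and bound: "\<And>x. x \<in> V \<Longrightarrow> \<bar>g x\<bar> \<le> \<phi> x"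
  shows "continuous_map X euclideanreal (\<lambda>x. if x \<in> V then g x else 0)"
proof -
  have VX: "V \<subseteq> topspace X" "P - V \<subseteq> topspace X" using V[THEN openin_subset] .
  have "openin X {x \<in> topspace X. (if x \<in> V then g x else 0) \<in> T}" if T: "open T" for T
  proof -
    have "openin (subtopology X V) {x \<in> topspace (subtopology X V). g x \<in> T}"
      using openin_continuous_map_preimage[OF g, of T] T by simp
    then have 1: "openin X {x \<in> V. g x \<in> T}"
      using V(1) VX by (simp add: openin_open_subtopology inf_absorb2)
    show ?thesis
    proof (cases "0 \<in> T")
      case False
      then have "{x \<in> topspace X. (if x \<in> V then g x else 0) \<in> T} = {x \<in> V. g x \<in> T}"
        using VX by auto
      then show ?thesis using 1 by simp
    next
      case True
      then obtain \<epsilon> where \<epsilon>: "\<epsilon> > 0" "ball 0 \<epsilon> \<subseteq> T" using T open_contains_ball by blast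
      have 2: "openin X {x \<in> topspace X. \<phi> x \<in> {..<\<epsilon>}}"
        by (rule openin_continuous_map_preimage[OF \<phi>]) auto
      have "x \<in> V \<Longrightarrow> \<phi> x < \<epsilon> \<Longrightarrow> g x \<in> T" for x
        using bound[of x] \<epsilon>(2) by (auto simp: subset_iff)
      \<comment> \<open>Points outside \<open>P\<close> fall into the second set, where
        \<open>\<phi>\<close> is below \<open>\<epsilon>\<close>, and points of \<open>P\<close>
        outside \<open>V\<close> into the third.\<close>
      then have "{x \<in> topspace X. (if x \<in> V then g x else 0) \<in> T} =
          {x \<in> V. g x \<in> T} \<union> {x \<in> topspace X. \<phi> x \<in> {..<\<epsilon>}} \<union> (P - V)"
        using VX zero \<epsilon>(1) True by auto
      then show ?thesis using 1 2 V(2) by auto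
    qed
  qed
  then show ?thesis by (simp add: continuous_map_def)
qed

section \<open>Splitting the preimage of a small open set\<close>

text \<open>Disjoint open pieces that fill the preimage are clopen in it. Index 0 is reserved for
  the piece near the thick part, which may be large; indexing by all natural numbers avoids carrying
  the number of pieces along.\<close>

definition thin_partition ::
    "'a topology \<Rightarrow> 'b topology \<Rightarrow> ('a \<Rightarrow> 'b) \<Rightarrow> 'a set set \<Rightarrow> 'a set \<Rightarrow> 'b set \<Rightarrow> (nat \<Rightarrow> 'a set) \<Rightarrow> bool" where
  "thin_partition X Y f \<omega> G U V \<longleftrightarrow>
     (\<forall>j. openin X (V j)) \<and> {x \<in> topspace X. f x \<in> U} = (\<Union>j. V j) \<and> disjoint_family V \<and>
     finite {j. V j \<noteq> {}} \<and> V 0 \<subseteq> G \<and> (\<forall>j>0. V j \<noteq> {} \<longrightarrow> (\<exists>W\<in>\<omega>. V j \<subseteq> W))"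

text \<open>The part of the fibre outside \<open>G\<close> is compact and consists of thin points.
  Finitely many of their clopen pieces, together with \<open>G\<close>, cover the fibre and hence
  all nearby fibres. Over a set \<open>U\<close> inside every \<open>U2 l\<close> these pieces can
  be subtracted from one another and remain open.\<close>

lemma thin_partition_over_neighbourhood:
  assumes X: "compactum X" and Y: "compactum Y" and f: "continuous_map X Y f"
    and G: "openin X G" "thick_part X Y f \<omega> \<subseteq> G"
    and y: "y \<in> U0" "openin Y U0"
  obtains U V where "openin Y U" "y \<in> U" "U \<subseteq> U0" "thin_partition X Y f \<omega> G U V"
proof -
  have cX: "compact_space X" and HY: "Hausdorff_space Y"
    using X Y metrizable_imp_Hausdorff_space by (auto simp: compactum_def)
  have yY: "y \<in> topspace Y" using y openin_subset by blast
  define F where "F = {x \<in> topspace X. f x = y}"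
  have "closedin Y {y}" using HY yY by (simp add: closedin_Hausdorff_singleton)
  then have "closedin X F"
    using closedin_continuous_map_preimage[OF f, of "{y}"] by (simp add: F_def)
  then have cF: "compactin X (F - G)" using cX G(1) closedin_compact_space by blast
  define Q where "Q x U V \<longleftrightarrow> openin Y U \<and> openin X V \<and> openin X ({z \<in> topspace X. f z \<in> U} - V) \<and>
      x \<in> V \<and> f ` V \<subseteq> U \<and> (\<exists>W\<in>\<omega>. V \<subseteq> W)" for x U V
  have "thin_at X Y f \<omega> x" if "x \<in> F - G" for x
    using that G(2) by (auto simp: thick_part_def F_def)
  then have "\<forall>x\<in>F - G. \<exists>U V. Q x U V" unfolding thin_at_def Q_def by blast
  then obtain U1 V1 where "\<And>x. x \<in> F - G \<Longrightarrow> Q x (U1 x) (V1 x)" by metis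
  then have UV1: "\<And>x. x \<in> F - G \<Longrightarrow> openin Y (U1 x) \<and> openin X (V1 x) \<and>
      openin X ({z \<in> topspace X. f z \<in> U1 x} - V1 x) \<and> x \<in> V1 x \<and> f ` V1 x \<subseteq> U1 x \<and> (\<exists>W\<in>\<omega>. V1 x \<subseteq> W)"
    unfolding Q_def .
  have op: "\<And>T. T \<in> V1 ` (F - G) \<Longrightarrow> openin X T" using UV1 by blast
  have "F - G \<subseteq> \<Union>(V1 ` (F - G))" using UV1 by blast
  then obtain \<F> where \<F>: "finite \<F>" "\<F> \<subseteq> V1 ` (F - G)" "F - G \<subseteq> \<Union>\<F>"
    using compactinD[OF cF op] by metis
  then obtain P where P: "finite P" "P \<subseteq> F - G" "F - G \<subseteq> \<Union>(V1 ` P)"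
    using finite_subset_image[OF \<F>(1,2)] by metis
  obtain p and q :: nat where p: "P = p ` {..<q}"
    using P(1) by (metis finite_imp_nat_seg_image_inj_on lessThan_def)
  define U2 V2 where "U2 l = U1 (p l)" and "V2 l = V1 (p l)" for l
  have UV: "openin Y (U2 l) \<and> openin X (V2 l) \<and> openin X ({z \<in> topspace X. f z \<in> U2 l} - V2 l) \<and>
      y \<in> U2 l \<and> (\<exists>W\<in>\<omega>. V2 l \<subseteq> W)" if "l < q" for l
  proof -
    have "p l \<in> F - G" using that p P(2) by blast
    moreover from this have "f (p l) = y" by (simp add: F_def)
    ultimately show ?thesis using UV1[of "p l"] unfolding U2_def V2_def by blast
  qed
  have "openin X (G \<union> (\<Union>l<q. V2 l))" using G(1) UV by auto
  moreover have "{x \<in> topspace X. f x = y} \<subseteq> G \<union> (\<Union>l<q. V2 l)"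
  proof -
    have "F \<subseteq> G \<union> (\<Union>l<q. V2 l)" using P(3) unfolding p V2_def by blast
    then show ?thesis unfolding F_def .
  qed
  ultimately obtain U3 where U3: "openin Y U3" "y \<in> U3" "{x \<in> topspace X. f x \<in> U3} \<subseteq> G \<union> (\<Union>l<q. V2 l)"
    using fibre_tube[OF cX HY f yY] by blast
  define U where "U = U0 \<inter> U3 \<inter> (topspace Y \<inter> (\<Inter>l<q. U2 l))"
  have Uop: "openin Y U"
  proof -
    have "openin Y (topspace Y \<inter> (\<Inter>l<q'. U2 l))" if "q' \<le> q" for q'
      using that
    proof (induction q')
      case (Suc q')
      then have "openin Y ((topspace Y \<inter> (\<Inter>l<q'. U2 l)) \<inter> U2 q')" using UV by auto
      then show ?case by (simp add: lessThan_Suc Int_ac)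
    qed simp
    then show ?thesis unfolding U_def using y U3 by auto
  qed
  have yU: "y \<in> U" using y U3 UV yY by (auto simp: U_def)
  define S where "S = {x \<in> topspace X. f x \<in> U}"
  have Sop: "openin X S" unfolding S_def using f Uop by (rule openin_continuous_map_preimage)
  \<comment> \<open>What is left of the preimage once the first \<open>l\<close> pieces are removed.
    It stays open because \<open>V2 l\<close> has an open complement in the preimage of
    \<open>U2 l\<close>, hence also over \<open>U\<close>.\<close>
  define T where "T l = {x \<in> S. \<forall>l'<l. x \<notin> V2 l'}" for l
  have Top: "openin X (T l)" if "l \<le> q" for l
    using that
  proof (induction l)
    case 0
    then show ?case using Sop by (simp add: T_def)
  next
    case (Suc l)
    then have "T (Suc l) = T l \<inter> ({z \<in> topspace X. f z \<in> U2 l} - V2 l)"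
      by (auto simp: T_def S_def U_def less_Suc_eq)
    then show ?case using Suc UV by auto
  qed
  \<comment> \<open>The final remainder takes index 0, so the piece cut out at stage
    \<open>l\<close> gets index \<open>Suc l\<close>.\<close>
  define V where "V j = (case j of 0 \<Rightarrow> T q | Suc l \<Rightarrow> if l < q then V2 l \<inter> T l else {})" for j
  have V0: "V 0 = T q" and VS: "\<And>l. V (Suc l) = (if l < q then V2 l \<inter> T l else {})" by (auto simp: V_def)
  have "thin_partition X Y f \<omega> G U V"
    unfolding thin_partition_def
  proof (intro conjI allI impI)
    show "openin X (V j)" for j
      using UV Top by (cases j) (auto simp: V0 VS)
    show "{x \<in> topspace X. f x \<in> U} = (\<Union>j. V j)"
    proof
      show "{x \<in> topspace X. f x \<in> U} \<subseteq> (\<Union>j. V j)"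
      proof
        fix x assume "x \<in> {x \<in> topspace X. f x \<in> U}"
        then have xS: "x \<in> S" by (simp add: S_def)
        show "x \<in> (\<Union>j. V j)"
        proof (cases "x \<in> T q")
          case True
          then show ?thesis using V0 by blast
        next
          case False
          then have ex: "\<exists>l. l < q \<and> x \<in> V2 l" using xS by (auto simp: T_def)
          define l where "l = (LEAST l. l < q \<and> x \<in> V2 l)"
          have l: "l < q \<and> x \<in> V2 l" unfolding l_def using ex by (rule LeastI_ex)
          moreover have "x \<notin> V2 l'" if "l' < l" for l'
            using not_less_Least[of l' "\<lambda>l. l < q \<and> x \<in> V2 l"] that l by (auto simp: l_def)
          ultimately have "x \<in> V (Suc l)" using xS by (auto simp: VS T_def)
          then show ?thesis by blast
        qed
      qed
      have "V j \<subseteq> S" for j by (cases j) (auto simp: V0 VS T_def)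
      then show "(\<Union>j. V j) \<subseteq> {x \<in> topspace X. f x \<in> U}" by (auto simp: S_def)
    qed
    show "disjoint_family V"
    proof -
      have "V i \<inter> V j = {}" if "i < j" for i j
        using that by (cases i; cases j) (auto simp: V0 VS T_def)
      then show ?thesis
        by (metis (no_types, lifting) disjoint_family_on_def inf_commute linorder_neqE_nat)
    qed
    show "finite {j. V j \<noteq> {}}"
    proof (rule finite_subset)
      show "{j. V j \<noteq> {}} \<subseteq> {..q}"
      proof
        fix j assume "j \<in> {j. V j \<noteq> {}}"
        then show "j \<in> {..q}" by (cases j) (auto simp: VS split: if_splits)
      qed
    qed simp
    show "V 0 \<subseteq> G" using U3(3) by (auto simp: V0 T_def S_def U_def)
    show "\<exists>W\<in>\<omega>. V j \<subseteq> W" if "j > 0" "V j \<noteq> {}" for j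
    proof (cases j)
      case (Suc l)
      then have "l < q" using that by (auto simp: VS split: if_splits)
      then show ?thesis using UV[of l] Suc by (auto simp: VS)
    qed (use that in simp)
  qed
  moreover have "U \<subseteq> U0" by (auto simp: U_def)
  ultimately show ?thesis using that Uop yU by blast
qed

lemma thin_partition_cover:
  assumes X: "compactum X" and Y: "compactum Y" and f: "continuous_map X Y f"
    and G: "openin X G" "thick_part X Y f \<omega> \<subseteq> G" and \<eta>: "open_cover_of Y \<eta>"
  obtains n :: nat and U V where "\<And>i. i < n \<Longrightarrow> openin Y (U i)" "\<And>i. i < n \<Longrightarrow> \<exists>W\<in>\<eta>. U i \<subseteq> W"
    "topspace Y \<subseteq> (\<Union>i<n. U i)" "\<And>i. i < n \<Longrightarrow> thin_partition X Y f \<omega> G (U i) (V i)"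
proof -
  have "\<exists>U V. openin Y U \<and> y \<in> U \<and> (\<exists>W\<in>\<eta>. U \<subseteq> W) \<and> thin_partition X Y f \<omega> G U V"
    if y: "y \<in> topspace Y" for y
  proof -
    have "y \<in> \<Union>\<eta>" using y \<eta> by (simp add: open_cover_of_def)
    then obtain W where W: "W \<in> \<eta>" "y \<in> W" by blast
    then have "openin Y W" using \<eta> by (simp add: open_cover_of_def)
    then show ?thesis
      using thin_partition_over_neighbourhood[OF X Y f G W(2)] W(1) by metis
  qed
  then obtain U V where UV: "\<And>y. y \<in> topspace Y \<Longrightarrow> openin Y (U y) \<and> y \<in> U y \<and> (\<exists>W\<in>\<eta>. U y \<subseteq> W) \<and>
      thin_partition X Y f \<omega> G (U y) (V y)" by metis
  have "compactin Y (topspace Y)" using Y by (simp add: compactum_def compact_space_def)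
  moreover have "\<And>T. T \<in> U ` topspace Y \<Longrightarrow> openin Y T" using UV by blast
  moreover have "topspace Y \<subseteq> \<Union>(U ` topspace Y)" using UV by blast
  ultimately obtain \<F> where \<F>: "finite \<F>" "\<F> \<subseteq> U ` topspace Y" "topspace Y \<subseteq> \<Union>\<F>"
    using compactinD by metis
  then obtain P where P: "finite P" "P \<subseteq> topspace Y" "topspace Y \<subseteq> \<Union>(U ` P)"
    using finite_subset_image[OF \<F>(1,2)] by metis
  obtain p and n :: nat where p: "P = p ` {..<n}"
    using P(1) by (metis finite_imp_nat_seg_image_inj_on lessThan_def)
  have pY: "p i \<in> topspace Y" if "i < n" for i using p P(2) that by blast
  show ?thesis
  proof (rule that[of n "\<lambda>i. U (p i)" "\<lambda>i. V (p i)"])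
    show "topspace Y \<subseteq> (\<Union>i<n. U (p i))" using P(3) p by auto
  qed (use UV[OF pY] in auto)
qed

section \<open>Staircase coordinates\<close>

text \<open>
  The length of the common part of \<open>[A i, A (i + 1)]\<close> and \<open>[B c, B (c + 1)]\<close>.  For cumulative
  sums \<open>A\<close>, \<open>B\<close> of barycentric coordinates these are the coordinates of a point of a product of two
  simplices in its staircase triangulation.
\<close>

definition overlap :: "(nat \<Rightarrow> real) \<Rightarrow> (nat \<Rightarrow> real) \<Rightarrow> nat \<Rightarrow> nat \<Rightarrow> real" where
  "overlap A B i c =
     max (A i) (min (A (Suc i)) (B (Suc c))) - max (A i) (min (A (Suc i)) (B c))"

lemma overlap_nonneg: "B c \<le> B (Suc c) \<Longrightarrow> 0 \<le> overlap A B i c"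
  by (auto simp: overlap_def)

text \<open>Each term is the increment, from \<open>B c\<close> to \<open>B (Suc c)\<close>, of the
  function that clamps to \<open>[A i, A (i + 1)]\<close>, so the sum telescopes.\<close>

lemma overlap_sum:
  assumes "A i \<le> A (Suc i)" "B 0 \<le> A i" "A (Suc i) \<le> B r"
  shows "(\<Sum>c<r. overlap A B i c) = A (Suc i) - A i"
proof -
  have "(\<Sum>c<r. overlap A B i c) =
      max (A i) (min (A (Suc i)) (B r)) - max (A i) (min (A (Suc i)) (B 0))"
    unfolding overlap_def by (rule sum_lessThan_telescope)
  then show ?thesis using assms by (simp add: max_def min_def)
qed

lemma overlap_pos:
  assumes "0 < overlap A B i c" "A i \<le> A (Suc i)" "B c \<le> B (Suc c)"
  shows "A i < A (Suc i)" "B c < B (Suc c)" "A i < B (Suc c)" "B c < A (Suc i)"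
  using assms by (auto simp: overlap_def max_def min_def split: if_splits)

text \<open>A later interval of \<open>A\<close> lies further to the right and cannot overlap an
  earlier interval of \<open>B\<close>. Thus the positive overlaps form a monotone path in the grid,
  which is a simplex of the staircase triangulation.\<close>

lemma overlap_chain:
  assumes A: "incseq A" and B: "incseq B"
    and pos: "0 < overlap A B i c" "0 < overlap A B i' c'" and "i < i'"
  shows "c \<le> c'"
proof (rule ccontr)
  assume "\<not> c \<le> c'"
  then have "B (Suc c') \<le> B c" "A (Suc i) \<le> A i'"
    using A B \<open>i < i'\<close> by (auto simp: incseq_def)
  moreover have "A i' < B (Suc c')" "B c < A (Suc i)"
    using overlap_pos[OF pos(2)] overlap_pos[OF pos(1)] A B by (auto simp: incseq_Suc_iff)
  ultimately show False by linarith
qed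

text \<open>Along a monotone path the rank of the row plus the rank of the column increases
  strictly. Counted from 0, it is at most the number of rows plus the number of columns minus
  2.\<close>

lemma card_chain_le:
  fixes S :: "(nat \<times> nat) set"
  assumes S: "finite S" "S \<noteq> {}"
    and chain: "\<And>i c i' c'. \<lbrakk>(i, c) \<in> S; (i', c') \<in> S; i < i'\<rbrakk> \<Longrightarrow> c \<le> c'"
  shows "card S + 1 \<le> card (fst ` S) + card (snd ` S)"
proof -
  \<comment> \<open>Ranks within the projections replace the indices themselves, since the
    projections may have gaps.\<close>
  define r where "r = (\<lambda>(i, c). card {a \<in> fst ` S. a < i} + card {b \<in> snd ` S. b < c})"
  have mono: "card {a \<in> T. a < i} \<le> card {a \<in> T. a < j}" if "finite T" "i \<le> j" for T :: "nat set" and i j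
    using that by (intro card_mono) auto
  have strict: "card {a \<in> T. a < i} < card {a \<in> T. a < j}" if "finite T" "i \<in> T" "i < j" for T :: "nat set" and i j
    using that by (intro psubset_card_mono) auto
  have top: "card {a \<in> T. a < i} < card T" if "finite T" "i \<in> T" for T :: "nat set" and i
    using that by (intro psubset_card_mono) auto
  have fin: "finite (fst ` S)" "finite (snd ` S)" using S by auto
  have lt: "r (i, c) < r (i', c')" if "(i, c) \<in> S" "(i', c') \<in> S" "i < i' \<or> i = i' \<and> c < c'" for i c i' c'
  proof -
    have mem: "i \<in> fst ` S" "c \<in> snd ` S" using that(1) by force+
    show ?thesis
      using that(3)
    proof
      assume i: "i < i'"
      then show ?thesis
        using strict[OF fin(1) mem(1) i] mono[OF fin(2) chain[OF that(1,2) i]] by (simp add: r_def)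
    next
      assume "i = i' \<and> c < c'"
      then show ?thesis using strict[OF fin(2) mem(2), of c'] by (simp add: r_def)
    qed
  qed
  have "inj_on r S"
  proof (rule inj_onI)
    fix x y assume xy: "x \<in> S" "y \<in> S" "r x = r y"
    show "x = y"
    proof (rule ccontr)
      assume "x \<noteq> y"
      obtain i c i' c' where e: "x = (i, c)" "y = (i', c')" by fastforce
      then have "i < i' \<or> i = i' \<and> c < c' \<or> i' < i \<or> i' = i \<and> c' < c" using \<open>x \<noteq> y\<close> by auto
      then show False using lt[of i c i' c'] lt[of i' c' i c] xy e by auto
    qed
  qed
  moreover have "r ` S \<subseteq> {..<card (fst ` S) + card (snd ` S) - 1}"
  proof
    fix z assume "z \<in> r ` S"
    then obtain i c where ic: "(i, c) \<in> S" "z = r (i, c)" by auto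
    have "i \<in> fst ` S" "c \<in> snd ` S" using ic(1) by force+
    then show "z \<in> {..<card (fst ` S) + card (snd ` S) - 1}"
      using top[OF fin(1), of i] top[OF fin(2), of c] ic(2) by (simp add: r_def)
  qed
  ultimately have "card S \<le> card (fst ` S) + card (snd ` S) - 1"
    using card_inj_on_le[of r S "{..<card (fst ` S) + card (snd ` S) - 1}"] by simp
  moreover have "card (fst ` S) > 0" using S by (simp add: card_gt_0_iff)
  ultimately show ?thesis by linarith
qed

section \<open>Coordinates that combine the thick and the thin pieces\<close>

text \<open>
  The vertex \<open>(i, 2 c)\<close> over \<open>i\<close> belongs to the \<open>c\<close>-th vertex of the nerve of the thick part, the
  vertex \<open>(i, 2 j + 1)\<close> to the small piece \<open>V i (j + 1)\<close>.
\<close>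

definition thick_thin_coordinates ::
    "nat \<Rightarrow> nat \<Rightarrow> (nat \<Rightarrow> nat \<Rightarrow> 'a set) \<Rightarrow> (nat \<Rightarrow> 'a \<Rightarrow> real) \<Rightarrow> (nat \<Rightarrow> 'a \<Rightarrow> real) \<Rightarrow> 'a \<Rightarrow> nat \<times> nat \<Rightarrow> real" where
  "thick_thin_coordinates n r V a b x = (\<lambda>(i, s).
     if i < n then
       if even s then
         if s div 2 < r \<and> x \<in> V i 0
         then overlap (\<lambda>i. \<Sum>j<i. a j x) (\<lambda>c. \<Sum>j<c. b j x) i (s div 2) else 0
       else if x \<in> V i (Suc (s div 2)) then a i x else 0
     else 0)"

text \<open>Both sequences of partial sums climb from 0 to 1, so the first \<open>r\<close>
  intervals of \<open>b\<close> cover each of the first \<open>n\<close> intervals of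
  \<open>a\<close>.\<close>

lemma overlap_partial_sums:
  assumes a: "\<And>i. 0 \<le> a i" "(\<Sum>i<n. a i) = 1" and b: "\<And>c. 0 \<le> b c" "(\<Sum>c<r. b c) = 1" and i: "i < n"
  shows "(\<Sum>c<r. overlap (\<lambda>i. \<Sum>j<i. a j) (\<lambda>c. \<Sum>j<c. b j) i c) = (a i :: real)"
proof -
  have "(\<Sum>j<Suc i. a j) \<le> (\<Sum>j<n. a j)" using a i by (intro sum_mono2) auto
  then have "(\<Sum>j<Suc i. a j) \<le> (\<Sum>c<r. b c)" using a b by simp
  then show ?thesis
    using a by (subst overlap_sum) (auto simp: sum_nonneg)
qed

context
  fixes n r :: nat and V :: "nat \<Rightarrow> nat \<Rightarrow> 'a set" and a b :: "nat \<Rightarrow> 'a \<Rightarrow> real" and x :: 'a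
  assumes a: "\<And>i. 0 \<le> a i x" "(\<Sum>i<n. a i x) = 1"
    and b: "\<And>c. 0 \<le> b c x"
    and b1: "\<And>i. \<lbrakk>i < n; x \<in> V i 0\<rbrakk> \<Longrightarrow> (\<Sum>c<r. b c x) = 1"
    and disj: "\<And>i. i < n \<Longrightarrow> disjoint_family (V i)"
    and cover: "\<And>i. \<lbrakk>i < n; 0 < a i x\<rbrakk> \<Longrightarrow> x \<in> (\<Union>j. V i j)"
begin

abbreviation (input) "coord \<equiv> thick_thin_coordinates n r V a b x"

lemma partial_sums_incseq:
  "incseq (\<lambda>i. \<Sum>j<i. a j x)" "incseq (\<lambda>c. \<Sum>j<c. b j x)"
  using a b by (auto simp: incseq_Suc_iff)

lemma thick_thin_coordinates_nonneg: "0 \<le> coord v"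
  using a b by (cases v) (auto simp: thick_thin_coordinates_def intro!: overlap_nonneg)

text \<open>This bound is what later permits extension by zero: the coordinates over
  \<open>i\<close> fade out together with the weight \<open>a i\<close>.\<close>

lemma thick_thin_coordinates_le:
  assumes "i < n" shows "coord (i, s) \<le> a i x"
proof (cases "even s \<and> s div 2 < r \<and> x \<in> V i 0")
  case True
  have "overlap (\<lambda>i. \<Sum>j<i. a j x) (\<lambda>c. \<Sum>j<c. b j x) i (s div 2) \<le>
      (\<Sum>c<r. overlap (\<lambda>i. \<Sum>j<i. a j x) (\<lambda>c. \<Sum>j<c. b j x) i c)"
    using True a b by (intro member_le_sum) (auto intro!: overlap_nonneg)
  also have "\<dots> = a i x"
    using True a b b1 assms by (intro overlap_partial_sums) auto
  finally show ?thesis using True assms by (simp add: thick_thin_coordinates_def)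
next
  case False
  then show ?thesis using a assms by (auto simp: thick_thin_coordinates_def)
qed

text \<open>It makes the projection to the first index carry the coordinates of \<open>x\<close> to
  the weights \<open>a i x\<close>. If \<open>x\<close> lies in the thick piece over
  \<open>i\<close>, the overlaps share the weight; if it lies in a thin piece, one vertex takes all
  of it; if it lies in no piece, the weight is 0.\<close>

lemma sum_thick_thin_coordinates:
  assumes i: "i < n" and r: "2 * r \<le> s" and s: "\<And>j. V i j \<noteq> {} \<Longrightarrow> 2 * j < s"
  shows "(\<Sum>t<s. coord (i, t)) = a i x"
proof (cases "x \<in> (\<Union>j. V i j)")
  case False
  then have "a i x = 0" using cover[OF i] a(1)[of i] by force
  moreover have "coord (i, t) = 0" for t
    using thick_thin_coordinates_le[OF i, of t] thick_thin_coordinates_nonneg[of "(i, t)"] calculation by simp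
  ultimately show ?thesis by simp
next
  case True
  then obtain j where j: "x \<in> V i j" by blast
  have uniq: "j' = j" if "x \<in> V i j'" for j'
    using disj[OF i] j that by (auto simp: disjoint_family_on_def)
  show ?thesis
  proof (cases j)
    case 0
    let ?o = "overlap (\<lambda>i. \<Sum>j<i. a j x) (\<lambda>c. \<Sum>j<c. b j x) i"
    have eq: "coord (i, t) = (if even t \<and> t div 2 < r then ?o (t div 2) else 0)" for t
      using i j 0 uniq by (auto simp: thick_thin_coordinates_def)
    have "(\<Sum>t<s. coord (i, t)) = (\<Sum>t\<in>(\<lambda>c. 2 * c) ` {..<r}. ?o (t div 2))"
      unfolding eq using r by (intro sum.mono_neutral_cong_right) (auto elim!: evenE)
    also have "\<dots> = (\<Sum>c<r. ?o c)" by (subst sum.reindex) (auto simp: inj_on_def)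
    also have "\<dots> = a i x" using a b b1[OF i] i j 0 by (intro overlap_partial_sums) auto
    finally show ?thesis .
  next
    case (Suc l)
    have eq: "coord (i, t) = (if t = 2 * l + 1 then a i x else 0)" for t
    proof (cases "even t")
      case True
      then show ?thesis using i uniq[of 0] Suc by (auto simp: thick_thin_coordinates_def)
    next
      case False
      then obtain l' where t: "t = 2 * l' + 1" using oddE by blast
      have "x \<in> V i (Suc l') \<longleftrightarrow> l' = l" using j uniq[of "Suc l'"] Suc by blast
      then show ?thesis using i t by (simp add: thick_thin_coordinates_def)
    qed
    \<comment> \<open>The piece \<open>j = Suc l\<close> has the vertex \<open>2 * l + 1\<close>,
      which is below \<open>2 * j\<close>.\<close>
    have "V i j \<noteq> {}" using j by blast
    then have "2 * j < s" by (rule s)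
    then have "2 * l + 1 < s" using Suc by simp
    then show ?thesis unfolding eq by (simp add: sum.delta)
  qed
qed

text \<open>The thick vertices form a monotone path with at most \<open>k + 1\<close> columns and
  exceed their rows by at most \<open>k\<close>. A thin piece adds one vertex per row, and no row is
  both thick and thin at \<open>x\<close>.\<close>

lemma card_thick_thin_support:
  assumes order: "card {c. c < r \<and> 0 < b c x} \<le> k + 1"
  shows "finite {v. 0 < coord v} \<and> card {v. 0 < coord v} \<le> card (fst ` {v. 0 < coord v}) + k"
proof -
  let ?A = "\<lambda>i. \<Sum>j<i. a j x" and ?B = "\<lambda>c. \<Sum>j<c. b j x"
  \<comment> \<open>\<open>S1\<close> and \<open>S2\<close> are the thick and the thin vertices of
    the support with the parity encoding removed.\<close>
  define S1 where "S1 = {(i, c). i < n \<and> c < r \<and> x \<in> V i 0 \<and> 0 < overlap ?A ?B i c}"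
  define S2 where "S2 = {(i, j). i < n \<and> x \<in> V i (Suc j) \<and> 0 < a i x}"
  have supp: "{v. 0 < coord v} = (\<lambda>(i, c). (i, 2 * c)) ` S1 \<union> (\<lambda>(i, j). (i, 2 * j + 1)) ` S2"
  proof
    show "{v. 0 < coord v} \<subseteq> (\<lambda>(i, c). (i, 2 * c)) ` S1 \<union> (\<lambda>(i, j). (i, 2 * j + 1)) ` S2"
    proof
      fix v assume v: "v \<in> {v. 0 < coord v}"
      obtain i s where iv: "v = (i, s)" by fastforce
      show "v \<in> (\<lambda>(i, c). (i, 2 * c)) ` S1 \<union> (\<lambda>(i, j). (i, 2 * j + 1)) ` S2"
      proof (cases "even s")
        case True
        then obtain c where "s = 2 * c" by blast
        then have "(i, c) \<in> S1" using v iv by (auto simp: thick_thin_coordinates_def S1_def split: if_splits)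
        then show ?thesis using iv \<open>s = 2 * c\<close> by force
      next
        case False
        then obtain j where "s = 2 * j + 1" using oddE by blast
        then have "(i, j) \<in> S2" using v iv by (auto simp: thick_thin_coordinates_def S2_def split: if_splits)
        then show ?thesis using iv \<open>s = 2 * j + 1\<close> by force
      qed
    qed
  qed (auto simp: thick_thin_coordinates_def S1_def S2_def)
  have inj2: "inj_on fst S2"
  proof (rule inj_onI)
    fix p q assume "p \<in> S2" "q \<in> S2" "fst p = fst q"
    then obtain i j j' where p: "p = (i, j)" "q = (i, j')" "i < n" "x \<in> V i (Suc j)" "x \<in> V i (Suc j')"
      by (auto simp: S2_def)
    then have "\<not> Suc j \<noteq> Suc j'" using disj[OF p(3)] unfolding disjoint_family_on_def by blast
    then show "p = q" using p by simp
  qed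
  have fin1: "finite S1" by (rule finite_subset[of _ "{..<n} \<times> {..<r}"]) (auto simp: S1_def)
  have "fst ` S2 \<subseteq> {..<n}" by (auto simp: S2_def)
  then have fin2: "finite S2" using inj2 finite_imageD finite_subset by blast
  have card1: "card S1 \<le> card (fst ` S1) + k"
  proof (cases "S1 = {}")
    case False
    have "snd ` S1 \<subseteq> {c. c < r \<and> 0 < b c x}"
    proof
      fix c assume "c \<in> snd ` S1"
      then obtain i where i: "(i, c) \<in> S1" by auto
      then have "?B c < ?B (Suc c)"
        using a b by (intro overlap_pos(2)[of ?A ?B i c]) (auto simp: S1_def)
      then show "c \<in> {c. c < r \<and> 0 < b c x}" using i by (auto simp: S1_def)
    qed
    then have "card (snd ` S1) \<le> k + 1"
      using order card_mono[of "{c. c < r \<and> 0 < b c x}" "snd ` S1"] by simp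
    moreover have chain: "c \<le> c'" if "(i, c) \<in> S1" "(i', c') \<in> S1" "i < i'" for i c i' c'
      using overlap_chain[OF partial_sums_incseq, of i c i' c'] that by (auto simp: S1_def)
    have "card S1 + 1 \<le> card (fst ` S1) + card (snd ` S1)"
      by (rule card_chain_le[OF fin1 False], erule (2) chain)
    ultimately show ?thesis by linarith
  qed simp
  have "card {v. 0 < coord v} \<le> card ((\<lambda>(i, c). (i, 2 * c)) ` S1) + card ((\<lambda>(i, j). (i, 2 * j + 1)) ` S2)"
    unfolding supp by (rule card_Un_le)
  also have "\<dots> \<le> card S1 + card S2"
    using fin1 fin2 by (intro add_mono card_image_le)
  also have "\<dots> \<le> card (fst ` S1) + k + card (fst ` S2)"
    using card1 card_image[OF inj2] by simp
  also have "\<dots> = card (fst ` S1 \<union> fst ` S2) + k"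
  proof -
    have "fst ` S1 \<inter> fst ` S2 = {}"
      using disj by (fastforce simp: S1_def S2_def disjoint_family_on_def)
    then show ?thesis using fin1 fin2 by (simp add: card_Un_disjoint)
  qed
  also have "fst ` S1 \<union> fst ` S2 = fst ` {v. 0 < coord v}"
    unfolding supp by (force simp: image_Un image_image case_prod_unfold)
  finally show ?thesis unfolding supp using fin1 fin2 by simp
qed

end

text \<open>Over \<open>i\<close>, each coordinate is a function on one piece extended by zero. The
  other pieces are open, and \<open>a i\<close> bounds the function and vanishes outside all pieces.
  Continuity of \<open>b c\<close> is therefore required only on the thick pieces.\<close>

lemma continuous_map_thick_thin_coordinates:
  assumes a: "\<And>i. i < n \<Longrightarrow> continuous_map X euclideanreal (a i)" "\<And>i x. x \<in> topspace X \<Longrightarrow> 0 \<le> a i x"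
      "\<And>x. x \<in> topspace X \<Longrightarrow> (\<Sum>i<n. a i x) = 1"
    and b: "\<And>i c. \<lbrakk>i < n; c < r\<rbrakk> \<Longrightarrow> continuous_map (subtopology X (V i 0)) euclideanreal (b c)"
      "\<And>c x. x \<in> topspace X \<Longrightarrow> 0 \<le> b c x" "\<And>i x. \<lbrakk>i < n; x \<in> V i 0\<rbrakk> \<Longrightarrow> (\<Sum>c<r. b c x) = 1"
    and V: "\<And>i j. i < n \<Longrightarrow> openin X (V i j)" "\<And>i. i < n \<Longrightarrow> disjoint_family (V i)"
    and cover: "\<And>i x. \<lbrakk>i < n; x \<in> topspace X; 0 < a i x\<rbrakk> \<Longrightarrow> x \<in> (\<Union>j. V i j)"
  shows "continuous_map X euclideanreal (\<lambda>x. thick_thin_coordinates n r V a b x v)"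
proof -
  obtain i s where v: "v = (i, s)" by fastforce
  have Pop: "openin X ((\<Union>j. V i j) - V i j')" if "i < n" for j'
  proof -
    have "x \<notin> V i j'" if "x \<in> V i j" "j \<noteq> j'" for x j
      using V(2)[OF \<open>i < n\<close>] that by (auto simp: disjoint_family_on_def)
    then have "(\<Union>j. V i j) - V i j' = (\<Union>j\<in>-{j'}. V i j)" by blast
    then show ?thesis using V(1)[OF that] by auto
  qed
  have zero: "a i x = 0" if "i < n" "x \<in> topspace X" "x \<notin> (\<Union>j. V i j)" for x
    using cover[OF that(1,2)] a(2)[OF that(2), of i] that(3) by force
  consider "\<not> i < n" | "i < n" "odd s" | "i < n" "even s" "\<not> s div 2 < r" | "i < n" "even s" "s div 2 < r"
    by blast
  then show ?thesis
  proof cases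
    case 1
    then show ?thesis by (simp add: v thick_thin_coordinates_def)
  next
    case 2
    have "continuous_map X euclideanreal (\<lambda>x. if x \<in> V i (Suc (s div 2)) then a i x else 0)"
    proof (rule continuous_map_extend_by_zero[OF a(1)[OF 2(1)] V(1)[OF 2(1)] Pop[OF 2(1)] zero[OF 2(1)]])
      show "continuous_map (subtopology X (V i (Suc (s div 2)))) euclideanreal (a i)"
        using a(1)[OF 2(1)] by (rule continuous_map_from_subtopology)
      show "\<bar>a i x\<bar> \<le> a i x" if "x \<in> V i (Suc (s div 2))" for x
        using a(2)[of x i] openin_subset[OF V(1)[OF 2(1)]] that by force
    qed auto
    then show ?thesis using 2 by (simp add: v thick_thin_coordinates_def)
  next
    case 3
    then show ?thesis by (simp add: v thick_thin_coordinates_def)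
  next
    case 4
    let ?g = "\<lambda>x. overlap (\<lambda>i. \<Sum>j<i. a j x) (\<lambda>c. \<Sum>j<c. b j x) i (s div 2)"
    have sub: "V i 0 \<subseteq> topspace X" using V(1)[OF 4(1)] by (rule openin_subset)
    have "continuous_map X euclideanreal (\<lambda>x. if x \<in> V i 0 then ?g x else 0)"
    proof (rule continuous_map_extend_by_zero[OF a(1)[OF 4(1)] V(1)[OF 4(1)] Pop[OF 4(1)] zero[OF 4(1)]])
      show "continuous_map (subtopology X (V i 0)) euclideanreal ?g"
        unfolding overlap_def using 4
        by (intro continuous_map_diff continuous_map_real_max continuous_map_real_min continuous_map_sum
            continuous_map_from_subtopology[OF a(1)] b(1)) auto
      show "\<bar>?g x\<bar> \<le> a i x" if x: "x \<in> V i 0" for x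
      proof -
        have xX: "x \<in> topspace X" using x sub by blast
        have "thick_thin_coordinates n r V a b x (i, s) \<le> a i x"
          using a(2,3)[OF xX] b(2)[OF xX] b(3) V(2) cover[OF _ xX] 4
          by (intro thick_thin_coordinates_le) auto
        moreover have "0 \<le> ?g x" using b(2)[OF xX] by (intro overlap_nonneg) auto
        ultimately show ?thesis using 4 x by (simp add: thick_thin_coordinates_def)
      qed
    qed auto
    then show ?thesis using 4 by (simp add: v thick_thin_coordinates_def)
  qed
qed

section \<open>Simplicial maps and their fibres\<close>

lemma topspace_polyhedron_of: "topspace (polyhedron_of K) = (\<Union>\<sigma>\<in>K. closed_simplex_on \<sigma>)"
  by (simp add: polyhedron_of_def)

lemma closed_simplex_on_le_1:
  assumes "finite \<sigma>" "x \<in> closed_simplex_on \<sigma>"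
  shows "x v \<le> 1"
proof (cases "v \<in> \<sigma>")
  case True
  then have "x v \<le> (\<Sum>v\<in>\<sigma>. x v)"
    using assms by (intro member_le_sum) (auto simp: closed_simplex_on_def)
  then show ?thesis using assms(2) by (simp add: closed_simplex_on_def)
qed (use assms(2) in \<open>simp add: closed_simplex_on_def\<close>)

section \<open>Fibres of a linear projection of simplices\<close>

text \<open>The defining conditions involve single coordinates or finite sums and are closed; all
  coordinates lie in the unit interval, so Tychonoff's theorem applies.\<close>

lemma compactin_simplex_fibre:
  fixes \<sigma> :: "nat set" and y :: "'w \<Rightarrow> real"
  assumes \<sigma>: "finite \<sigma>" and E: "finite E"
  shows "compactin (powertop_real UNIV)
    {x \<in> closed_simplex_on \<sigma>. (\<lambda>w. \<Sum>v\<in>{v\<in>E. \<pi> v = w}. x v) = y}" (is "compactin _ ?A")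
proof -
  have cont: "continuous_on UNIV (\<lambda>x::nat \<Rightarrow> real. x v)" for v
    by (rule continuous_on_product_coordinates)
  have "?A = (\<Inter>v. {x. 0 \<le> x v}) \<inter> (\<Inter>v\<in>-\<sigma>. {x. x v = 0}) \<inter> {x. (\<Sum>v\<in>\<sigma>. x v) = 1} \<inter>
      (\<Inter>w. {x. (\<Sum>v\<in>{v\<in>E. \<pi> v = w}. x v) = y w})"
    by (auto simp: closed_simplex_on_def fun_eq_iff)
  moreover have "closed \<dots>"
    by (intro closed_Int closed_INT ballI closed_Collect_le closed_Collect_eq continuous_on_sum cont continuous_on_const)
  ultimately have "closed ?A" by simp
  then have "closedin (powertop_real UNIV) ?A"
    by (simp add: euclidean_product_topology)
  moreover have "?A \<subseteq> PiE UNIV (\<lambda>_. {0..1})"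
    using closed_simplex_on_le_1[OF \<sigma>] by (auto simp: closed_simplex_on_def)
  moreover have "compactin (powertop_real UNIV) (PiE UNIV (\<lambda>_::nat. {0..1::real}))"
    by (simp add: compactin_PiE)
  ultimately show ?thesis using closed_compactin by blast
qed

text \<open>Dropping a vertex removes at most one image. Hence the excess does not grow on faces,
  and bounding it on the supports of points bounds it on the whole complex.\<close>

lemma card_fibre_excess_mono:
  assumes "finite S" "T \<subseteq> S"
  shows "card T + card (\<pi> ` S) \<le> card S + card (\<pi> ` T)"
proof -
  have "card (\<pi> ` S) \<le> card (\<pi> ` T \<union> \<pi> ` (S - T))"
    using assms by (intro card_mono) (auto simp: finite_subset)
  also have "\<dots> \<le> card (\<pi> ` T) + card (\<pi> ` (S - T))" by (rule card_Un_le)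
  also have "card (\<pi> ` (S - T)) \<le> card (S - T)" using assms by (intro card_image_le) auto
  finally show ?thesis
    using assms card_mono[OF assms] by (simp add: card_Diff_subset finite_subset)
qed

text \<open>One vertex \<open>s w\<close> is singled out over each \<open>w\<close>. Since the
  weights over \<open>w\<close> add up to the prescribed \<open>y w\<close>, its coordinate is
  determined by those of the other vertices over \<open>w\<close>. The vertices not singled out
  number at most \<open>k\<close>, and their coordinates separate the points of the fibre.\<close>

lemma covering_dim_le_simplex_fibre:
  fixes \<sigma> :: "nat set" and y :: "'w \<Rightarrow> real"
  assumes E: "finite E" "\<sigma> \<subseteq> E" and k: "card \<sigma> \<le> card (\<pi> ` \<sigma>) + k"
  shows "covering_dim_le (subtopology (powertop_real UNIV)
    {x \<in> closed_simplex_on \<sigma>. (\<lambda>w. \<Sum>v\<in>{v\<in>E. \<pi> v = w}. x v) = y}) k"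
    (is "covering_dim_le (subtopology _ ?A) k")
proof -
  have \<sigma>: "finite \<sigma>" using E finite_subset by blast
  define s where "s w = (SOME v. v \<in> \<sigma> \<and> \<pi> v = w)" for w
  have s: "s w \<in> \<sigma> \<and> \<pi> (s w) = w" if "w \<in> \<pi> ` \<sigma>" for w
    unfolding s_def by (rule someI_ex) (use that in blast)
  define J where "J = \<sigma> - s ` \<pi> ` \<sigma>"
  have "inj_on s (\<pi> ` \<sigma>)" by (rule inj_on_inverseI[of _ \<pi>]) (use s in blast)
  then have "card (s ` \<pi> ` \<sigma>) = card (\<pi> ` \<sigma>)" by (rule card_image)
  moreover have "s ` \<pi> ` \<sigma> \<subseteq> \<sigma>" using s by blast
  ultimately have cardJ: "card J \<le> k"
    unfolding J_def using k \<sigma> by (simp add: card_Diff_subset)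
  show ?thesis
  proof (rule covering_dim_le_injective_coordinates[where h = "\<lambda>x v. x v" and J = J])
    show "compact_space (subtopology (powertop_real UNIV) ?A)"
      by (intro compact_space_subtopology compactin_simplex_fibre \<sigma> E(1))
    show "finite J" "card J \<le> k" using \<sigma> cardJ by (auto simp: J_def)
    show "continuous_map (subtopology (powertop_real UNIV) ?A) euclideanreal (\<lambda>x. x v)" for v
      by (intro continuous_map_from_subtopology continuous_map_product_projection) auto
    fix x x' assume "x \<in> topspace (subtopology (powertop_real UNIV) ?A)"
      "x' \<in> topspace (subtopology (powertop_real UNIV) ?A)" and eq: "\<And>v. v \<in> J \<Longrightarrow> x v = x' v"
    then have A: "x \<in> ?A" "x' \<in> ?A" by auto
    show "x = x'"
    proof
      fix v
      consider "v \<notin> \<sigma>" | "v \<in> J" | w where "w \<in> \<pi> ` \<sigma>" "v = s w" unfolding J_def by blast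
      then show "x v = x' v"
      proof cases
        case 1
        then show ?thesis using A by (simp add: closed_simplex_on_def)
      next
        case 2
        then show ?thesis by (rule eq)
      next
        case 3
        let ?R = "{u \<in> \<sigma>. \<pi> u = w} - {v}"
        have *: "z v = y w - (\<Sum>u\<in>?R. z u)" if z: "z \<in> ?A" for z
        proof -
          have "y w = (\<Sum>u\<in>{u\<in>E. \<pi> u = w}. z u)" using z by auto
          also have "\<dots> = (\<Sum>u\<in>{u\<in>\<sigma>. \<pi> u = w}. z u)"
            using E z by (intro sum.mono_neutral_right) (auto simp: closed_simplex_on_def)
          also have "\<dots> = z v + (\<Sum>u\<in>?R. z u)"
            using s[OF 3(1)] 3(2) \<sigma> by (intro sum.remove) auto
          finally show ?thesis by simp
        qed
        have "u \<in> J" if "u \<in> ?R" for u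
          using that 3(2) s unfolding J_def by auto
        then have "(\<Sum>u\<in>?R. x u) = (\<Sum>u\<in>?R. x' u)" using eq by (intro sum.cong) auto
        then show ?thesis using *[OF A(1)] *[OF A(2)] by simp
      qed
    qed
  qed
qed

lemma closed_simplex_on_image:
  fixes \<pi> :: "nat \<Rightarrow> 'w"
  assumes E: "finite E" "\<sigma> \<subseteq> E"
  shows "(\<lambda>x w. \<Sum>v\<in>{v\<in>E. \<pi> v = w}. x v) ` closed_simplex_on \<sigma> = closed_simplex_on (\<pi> ` \<sigma>)"
    (is "?p ` _ = _")
proof
  have \<sigma>: "finite \<sigma>" using E finite_subset by blast
  have p: "?p x w = (\<Sum>v\<in>{v\<in>\<sigma>. \<pi> v = w}. x v)" if "\<And>v. v \<notin> \<sigma> \<Longrightarrow> x v = 0" for x :: "nat \<Rightarrow> real" and w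
    using E that by (intro sum.mono_neutral_right) auto
  show "?p ` closed_simplex_on \<sigma> \<subseteq> closed_simplex_on (\<pi> ` \<sigma>)"
  proof
    fix z assume "z \<in> ?p ` closed_simplex_on \<sigma>"
    then obtain x where x: "x \<in> closed_simplex_on \<sigma>" "z = ?p x" by blast
    then have z: "z w = (\<Sum>v\<in>{v\<in>\<sigma>. \<pi> v = w}. x v)" for w
      using p[of x w] by (simp add: closed_simplex_on_def)
    have "(\<Sum>w\<in>\<pi> ` \<sigma>. z w) = (\<Sum>v\<in>\<sigma>. x v)"
      unfolding z using \<sigma> by (intro sum.group) auto
    moreover have "z w = 0" if "w \<notin> \<pi> ` \<sigma>" for w
    proof -
      have "{v\<in>\<sigma>. \<pi> v = w} = {}" using that by blast
      then show ?thesis unfolding z by (simp only: sum.empty)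
    qed
    moreover have "0 \<le> z w" for w unfolding z using x(1) by (intro sum_nonneg) (auto simp: closed_simplex_on_def)
    ultimately show "z \<in> closed_simplex_on (\<pi> ` \<sigma>)"
      using x(1) by (auto simp: closed_simplex_on_def)
  qed
  show "closed_simplex_on (\<pi> ` \<sigma>) \<subseteq> ?p ` closed_simplex_on \<sigma>"
  proof
    fix z assume z: "z \<in> closed_simplex_on (\<pi> ` \<sigma>)"
    define s where "s w = (SOME v. v \<in> \<sigma> \<and> \<pi> v = w)" for w
    have s: "s w \<in> \<sigma> \<and> \<pi> (s w) = w" if "w \<in> \<pi> ` \<sigma>" for w
      unfolding s_def by (rule someI_ex) (use that in blast)
    \<comment> \<open>A preimage of \<open>z\<close> puts all the weight of \<open>w\<close> on the
      chosen vertex \<open>s w\<close>.\<close>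
    define x where "x v = (if v \<in> s ` \<pi> ` \<sigma> then z (\<pi> v) else 0)" for v
    have x0: "x v = 0" if "v \<notin> \<sigma>" for v using that s by (auto simp: x_def)
    have xz: "(\<Sum>v\<in>{v\<in>\<sigma>. \<pi> v = w}. x v) = z w" for w
    proof (cases "w \<in> \<pi> ` \<sigma>")
      case True
      have "x v = (if v = s w then z w else 0)" if "v \<in> {v\<in>\<sigma>. \<pi> v = w}" for v
        using that s True by (auto simp: x_def)
      then have "(\<Sum>v\<in>{v\<in>\<sigma>. \<pi> v = w}. x v) = (\<Sum>v\<in>{v\<in>\<sigma>. \<pi> v = w}. if v = s w then z w else 0)"
        by (intro sum.cong) auto
      then show ?thesis using \<sigma> s[OF True] by (simp add: sum.delta)
    next
      case False
      then have "{v\<in>\<sigma>. \<pi> v = w} = {}" by blast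
      then have "(\<Sum>v\<in>{v\<in>\<sigma>. \<pi> v = w}. x v) = 0" by (simp only: sum.empty)
      then show ?thesis using z False by (simp add: closed_simplex_on_def)
    qed
    have "?p x = z" using p[OF x0] xz by auto
    moreover have "x \<in> closed_simplex_on \<sigma>"
    proof -
      have "(\<Sum>v\<in>\<sigma>. x v) = (\<Sum>w\<in>\<pi> ` \<sigma>. \<Sum>v\<in>{v\<in>\<sigma>. \<pi> v = w}. x v)"
        using \<sigma> by (intro sum.group[symmetric]) auto
      also have "\<dots> = 1" unfolding xz using z by (simp add: closed_simplex_on_def)
      finally show ?thesis using x0 z by (auto simp: closed_simplex_on_def x_def)
    qed
    ultimately show "z \<in> ?p ` closed_simplex_on \<sigma>" by blast
  qed
qed

section \<open>Complexes of supports and the maps given by barycentric coordinates\<close>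

lemma support_complex_locally_finite:
  assumes E: "finite E" and supp: "\<And>x. x \<in> A \<Longrightarrow> S x \<subseteq> E"
  shows "finite {\<sigma>. \<sigma> \<noteq> {} \<and> (\<exists>x\<in>A. \<sigma> \<subseteq> S x)}"
    and "locally_finite_complex {\<sigma>. \<sigma> \<noteq> {} \<and> (\<exists>x\<in>A. \<sigma> \<subseteq> S x)}"
proof -
  have "{\<sigma>. \<sigma> \<noteq> {} \<and> (\<exists>x\<in>A. \<sigma> \<subseteq> S x)} \<subseteq> Pow E" using supp by blast
  then show fin: "finite {\<sigma>. \<sigma> \<noteq> {} \<and> (\<exists>x\<in>A. \<sigma> \<subseteq> S x)}"
    using E finite_subset by blast
  have "finite \<sigma>" if "\<exists>x\<in>A. \<sigma> \<subseteq> S x" for \<sigma>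
    using that supp E by (meson finite_subset)
  then have "abstract_complex {\<sigma>. \<sigma> \<noteq> {} \<and> (\<exists>x\<in>A. \<sigma> \<subseteq> S x)}"
    unfolding abstract_complex_def by blast
  then show "locally_finite_complex {\<sigma>. \<sigma> \<noteq> {} \<and> (\<exists>x\<in>A. \<sigma> \<subseteq> S x)}"
    using rev_finite_subset[OF fin] by (simp add: locally_finite_complex_def Collect_mono_iff)
qed

text \<open>The polyhedron is covered by the open stars of its vertices, and the preimage of the
  star of \<open>v\<close> is the set where the coordinate \<open>v\<close> is positive.\<close>

lemma omega_map_barycentric:
  fixes \<kappa> :: "'a \<Rightarrow> nat \<Rightarrow> real"
  assumes E: "finite E"
    and cont: "\<And>v. continuous_map X euclideanreal (\<lambda>x. \<kappa> x v)"
    and nonneg: "\<And>x v. x \<in> topspace X \<Longrightarrow> 0 \<le> \<kappa> x v"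
    and supp: "\<And>x v. \<lbrakk>x \<in> topspace X; v \<notin> E\<rbrakk> \<Longrightarrow> \<kappa> x v = 0"
    and sum1: "\<And>x. x \<in> topspace X \<Longrightarrow> (\<Sum>v\<in>E. \<kappa> x v) = 1"
    and small: "\<And>x v. \<lbrakk>x \<in> topspace X; 0 < \<kappa> x v\<rbrakk> \<Longrightarrow> \<exists>W\<in>\<omega>. {z \<in> topspace X. 0 < \<kappa> z v} \<subseteq> W"
  shows "omega_map X \<omega> (polyhedron_of {\<sigma>. \<sigma> \<noteq> {} \<and> (\<exists>x\<in>topspace X. \<sigma> \<subseteq> {v. 0 < \<kappa> x v})}) \<kappa>"
    (is "omega_map X \<omega> (polyhedron_of ?K) \<kappa>")
proof -
  have \<kappa>: "{v. 0 < \<kappa> x v} \<in> ?K \<and> \<kappa> x \<in> closed_simplex_on {v. 0 < \<kappa> x v}" if x: "x \<in> topspace X" for x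
  proof -
    have "{v. 0 < \<kappa> x v} \<subseteq> E" using supp[OF x] by force
    then have "(\<Sum>v\<in>{v. 0 < \<kappa> x v}. \<kappa> x v) = (\<Sum>v\<in>E. \<kappa> x v)"
      using E nonneg[OF x] by (intro sum.mono_neutral_left) (auto simp: order.order_iff_strict)
    then have 1: "(\<Sum>v\<in>{v. 0 < \<kappa> x v}. \<kappa> x v) = 1" using sum1[OF x] by simp
    then have "{v. 0 < \<kappa> x v} \<noteq> {}" by (metis sum.empty zero_neq_one)
    moreover have "\<kappa> x v = 0" if "\<not> 0 < \<kappa> x v" for v using nonneg[OF x, of v] that by simp
    ultimately show ?thesis using x 1 nonneg[OF x] by (auto simp: closed_simplex_on_def)
  qed
  have mem: "\<kappa> x \<in> (\<Union>\<sigma>\<in>?K. closed_simplex_on \<sigma>)" if "x \<in> topspace X" for x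
    by (rule UN_I[where a = "{v. 0 < \<kappa> x v}" and B = closed_simplex_on, OF conjunct1[OF \<kappa>[OF that]] conjunct2[OF \<kappa>[OF that]]])
  have "continuous_map X (polyhedron_of ?K) \<kappa>"
    unfolding polyhedron_of_def continuous_map_in_subtopology continuous_map_componentwise_UNIV
    by (intro conjI allI cont Pi_I mem)
  moreover have "\<exists>\<W>. open_cover_of (polyhedron_of ?K) \<W> \<and>
      (\<forall>W\<in>\<W>. \<exists>U\<in>\<omega>. {x \<in> topspace X. \<kappa> x \<in> W} \<subseteq> U)"
  proof (intro exI conjI)
    let ?S = "\<lambda>v. {z \<in> topspace (polyhedron_of ?K). z v \<in> {0<..}}"
    have "openin (polyhedron_of ?K) (?S v)" for v
    proof -
      have "continuous_map (polyhedron_of ?K) euclideanreal (\<lambda>z. z v)"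
        unfolding polyhedron_of_def
        by (intro continuous_map_from_subtopology continuous_map_product_projection) auto
      then show ?thesis by (rule openin_continuous_map_preimage) auto
    qed
    moreover have "\<exists>v\<in>\<Union>?K. z v > 0" if z: "z \<in> topspace (polyhedron_of ?K)" for z
    proof (rule ccontr)
      assume neg: "\<not> ?thesis"
      obtain \<sigma> where \<sigma>: "\<sigma> \<in> ?K" "z \<in> closed_simplex_on \<sigma>"
        using z by (auto simp: topspace_polyhedron_of)
      have "z v = 0" if "v \<in> \<sigma>" for v
      proof -
        have "\<not> 0 < z v" using neg \<sigma>(1) that by blast
        moreover have "0 \<le> z v" using \<sigma>(2) by (simp add: closed_simplex_on_def)
        ultimately show ?thesis by simp
      qed
      then have "(\<Sum>v\<in>\<sigma>. z v) = 0" by simp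
      then show False using \<sigma>(2) by (simp add: closed_simplex_on_def)
    qed
    ultimately show "open_cover_of (polyhedron_of ?K) (?S ` \<Union>?K)"
      unfolding open_cover_of_def by auto
    show "\<forall>W\<in>?S ` \<Union>?K. \<exists>U\<in>\<omega>. {x \<in> topspace X. \<kappa> x \<in> W} \<subseteq> U"
    proof
      fix W assume "W \<in> ?S ` \<Union>?K"
      \<comment> \<open>A vertex of the complex has a positive coordinate at some point of
        \<open>X\<close>, as the hypothesis \<open>small\<close> requires.\<close>
      then obtain v x where v: "W = ?S v" "x \<in> topspace X" "0 < \<kappa> x v" by blast
      have "{x \<in> topspace X. \<kappa> x \<in> W} \<subseteq> {z \<in> topspace X. 0 < \<kappa> z v}" using v(1) by auto
      then show "\<exists>U\<in>\<omega>. {x \<in> topspace X. \<kappa> x \<in> W} \<subseteq> U" using small[OF v(2,3)] by blast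
    qed
  qed
  ultimately show ?thesis by (simp add: omega_map_def)
qed

text \<open>\<open>\<kappa>\<close> and \<open>\<mu>\<close> are barycentric coordinates,
  \<open>\<pi>\<close> is the vertex map, and \<open>compat\<close> says that the weights over
  \<open>w\<close> add up to the weight of \<open>w\<close>. Then \<open>p\<close> is the linear
  extension of \<open>\<pi>\<close>. Its fibres are finite unions of closed fibres in simplices,
  each of which inherits the bound on the excess from the support of a point.\<close>

lemma simplicial_approximation_from_coordinates:
  fixes \<kappa> :: "'a \<Rightarrow> nat \<Rightarrow> real" and \<mu> :: "'b \<Rightarrow> nat \<Rightarrow> real" and \<pi> :: "nat \<Rightarrow> nat"
  assumes f: "continuous_map X Y f" and E: "finite E" and F: "finite F" "\<pi> ` E \<subseteq> F"
    and cont: "\<And>v. continuous_map X euclideanreal (\<lambda>x. \<kappa> x v)" "\<And>w. continuous_map Y euclideanreal (\<lambda>y. \<mu> y w)"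
    and nonneg: "\<And>x v. x \<in> topspace X \<Longrightarrow> 0 \<le> \<kappa> x v" "\<And>y w. y \<in> topspace Y \<Longrightarrow> 0 \<le> \<mu> y w"
    and supp: "\<And>x v. \<lbrakk>x \<in> topspace X; v \<notin> E\<rbrakk> \<Longrightarrow> \<kappa> x v = 0" "\<And>y w. \<lbrakk>y \<in> topspace Y; w \<notin> F\<rbrakk> \<Longrightarrow> \<mu> y w = 0"
    and sum1: "\<And>y. y \<in> topspace Y \<Longrightarrow> (\<Sum>w\<in>F. \<mu> y w) = 1"
    and compat: "\<And>x w. x \<in> topspace X \<Longrightarrow> (\<Sum>v\<in>{v\<in>E. \<pi> v = w}. \<kappa> x v) = \<mu> (f x) w"
    and small: "\<And>x v. \<lbrakk>x \<in> topspace X; 0 < \<kappa> x v\<rbrakk> \<Longrightarrow> \<exists>W\<in>\<omega>. {z \<in> topspace X. 0 < \<kappa> z v} \<subseteq> W"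
      "\<And>y w. \<lbrakk>y \<in> topspace Y; 0 < \<mu> y w\<rbrakk> \<Longrightarrow> \<exists>W\<in>\<eta>. {z \<in> topspace Y. 0 < \<mu> z w} \<subseteq> W"
    and k: "\<And>x. x \<in> topspace X \<Longrightarrow> card {v. 0 < \<kappa> x v} \<le> card (\<pi> ` {v. 0 < \<kappa> x v}) + k"
  shows "\<exists>(K :: nat set set) (L :: nat set set) \<kappa>X \<kappa>Y p.
           locally_finite_complex K \<and> locally_finite_complex L \<and>
           omega_map X \<omega> (polyhedron_of K) \<kappa>X \<and>
           omega_map Y \<eta> (polyhedron_of L) \<kappa>Y \<and>
           simplicial_map_between K L p \<and>
           dimensional_map k (polyhedron_of K) (polyhedron_of L) p \<and>
           (\<forall>x \<in> topspace X. p (\<kappa>X x) = \<kappa>Y (f x))"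
proof -
  define K where "K = {\<sigma>. \<sigma> \<noteq> {} \<and> (\<exists>x\<in>topspace X. \<sigma> \<subseteq> {v. 0 < \<kappa> x v})}"
  define L where "L = {\<tau>. \<tau> \<noteq> {} \<and> (\<exists>y\<in>topspace Y. \<tau> \<subseteq> {w. 0 < \<mu> y w})}"
  define p where "p z w = (\<Sum>v\<in>{v\<in>E. \<pi> v = w}. z v)" for z :: "nat \<Rightarrow> real" and w
  have p_eq: "p = (\<lambda>z w. \<Sum>v\<in>{v\<in>E. \<pi> v = w}. z v)" by (simp add: p_def fun_eq_iff)
  have fX: "f x \<in> topspace Y" if "x \<in> topspace X" for x using f that by (auto simp: continuous_map_def)
  have suppE: "{v. 0 < \<kappa> x v} \<subseteq> E" if "x \<in> topspace X" for x using supp(1)[OF that] by force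
  have suppF: "{w. 0 < \<mu> y w} \<subseteq> F" if "y \<in> topspace Y" for y using supp(2)[OF that] by force
  have KE: "\<sigma> \<subseteq> E" if "\<sigma> \<in> K" for \<sigma> using that suppE unfolding K_def by blast
  have finK: "finite K"
    unfolding K_def by (rule support_complex_locally_finite(1)[OF E suppE])
  have lfK: "locally_finite_complex K"
    unfolding K_def by (rule support_complex_locally_finite(2)[OF E suppE])
  have lfL: "locally_finite_complex L"
    unfolding L_def by (rule support_complex_locally_finite(2)[OF F(1) suppF])
  have "(\<Sum>v\<in>E. \<kappa> x v) = 1" if x: "x \<in> topspace X" for x
  proof -
    have "(\<Sum>v\<in>E. \<kappa> x v) = (\<Sum>w\<in>F. \<Sum>v\<in>{v\<in>E. \<pi> v = w}. \<kappa> x v)"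
      using E F by (intro sum.group[symmetric])
    then show ?thesis using compat[OF x] sum1[OF fX[OF x]] by simp
  qed
  then have oX: "omega_map X \<omega> (polyhedron_of K) \<kappa>"
    unfolding K_def using E cont(1) nonneg(1) supp(1) small(1) by (intro omega_map_barycentric[of E]) auto
  have oY: "omega_map Y \<eta> (polyhedron_of L) \<mu>"
    unfolding L_def using F(1) cont(2) nonneg(2) supp(2) sum1 small(2) by (intro omega_map_barycentric[of F]) auto
  have pK: "p ` closed_simplex_on \<sigma> = closed_simplex_on (\<pi> ` \<sigma>)" if "\<sigma> \<in> K" for \<sigma>
    unfolding p_eq by (rule closed_simplex_on_image[OF E KE[OF that]])
  have \<pi>K: "\<pi> ` \<sigma> \<in> L" if \<sigma>: "\<sigma> \<in> K" for \<sigma>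
  proof -
    obtain x where x: "x \<in> topspace X" "\<sigma> \<subseteq> {v. 0 < \<kappa> x v}" "\<sigma> \<noteq> {}" using \<sigma> unfolding K_def by blast
    have "0 < \<mu> (f x) (\<pi> v)" if v: "v \<in> \<sigma>" for v
    proof -
      have "v \<in> {v'\<in>E. \<pi> v' = \<pi> v}" using v KE[OF \<sigma>] by blast
      then have "\<kappa> x v \<le> (\<Sum>v'\<in>{v'\<in>E. \<pi> v' = \<pi> v}. \<kappa> x v')"
        using E nonneg(1)[OF x(1)] by (intro member_le_sum) auto
      then show ?thesis using compat[OF x(1)] x(2) v by force
    qed
    then show ?thesis using x fX[OF x(1)] unfolding L_def by blast
  qed
  have contp: "continuous_map (polyhedron_of K) (polyhedron_of L) p"
  proof -
    have 1: "continuous_map (polyhedron_of K) euclideanreal (\<lambda>z. p z w)" for w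
      unfolding polyhedron_of_def p_def using E
      by (intro continuous_map_sum continuous_map_from_subtopology continuous_map_product_projection) auto
    have 2: "p z \<in> (\<Union>\<tau>\<in>L. closed_simplex_on \<tau>)" if "z \<in> topspace (polyhedron_of K)" for z
      using that pK \<pi>K unfolding topspace_polyhedron_of by blast
    show ?thesis
      unfolding polyhedron_of_def[of L] continuous_map_in_subtopology continuous_map_componentwise_UNIV
      by (intro conjI allI Pi_I 1 2)
  qed
  have "p (\<lambda>v. (1 - t) * x v + t * y v) = (\<lambda>w. (1 - t) * p x w + t * p y w)" for x y t
    by (simp add: p_def fun_eq_iff sum.distrib sum_distrib_left)
  then have simp_p: "simplicial_map_between K L p"
    unfolding simplicial_map_between_def using contp pK \<pi>K by blast
  have "covering_dim_le (subtopology (polyhedron_of K) {z \<in> topspace (polyhedron_of K). p z = y}) k" for y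
  proof -
    let ?S = "{z \<in> topspace (polyhedron_of K). p z = y}"
    let ?A = "\<lambda>\<sigma>. {z \<in> closed_simplex_on \<sigma>. p z = y}"
    obtain \<sigma> and q :: nat where \<sigma>: "K = \<sigma> ` {..<q}"
      using finK by (metis finite_imp_nat_seg_image_inj_on lessThan_def)
    have \<sigma>K: "\<sigma> l \<in> K" if "l < q" for l using \<sigma> that by blast
    have sub: "?A (\<sigma> l) \<subseteq> ?S" if "l < q" for l
      using \<sigma>K[OF that] by (auto simp: topspace_polyhedron_of)
    have eq: "subtopology (polyhedron_of K) ?S = subtopology (powertop_real UNIV) ?S"
      unfolding polyhedron_of_def by (simp add: subtopology_subtopology inf_absorb2 subset_iff)
    have "covering_dim_le (subtopology (powertop_real UNIV) ?S) k"
    proof (rule covering_dim_le_finite_closed_Union)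
      fix l assume l: "l < q"
      have "compactin (powertop_real UNIV) (?A (\<sigma> l))"
        using compactin_simplex_fibre[OF _ E, of "\<sigma> l" \<pi> y] finite_subset[OF KE[OF \<sigma>K[OF l]] E]
        unfolding p_eq by simp
      moreover have "Hausdorff_space (powertop_real (UNIV :: nat set))"
        by (simp add: Hausdorff_space_product_topology)
      ultimately have "closedin (powertop_real UNIV) (?A (\<sigma> l))"
        by (intro compactin_imp_closedin)
      then show "closedin (subtopology (powertop_real UNIV) ?S) (?A (\<sigma> l))"
        using sub[OF l] by (intro closedin_subset_topspace)
      obtain x where x: "x \<in> topspace X" "\<sigma> l \<subseteq> {v. 0 < \<kappa> x v}"
        using \<sigma>K[OF l] unfolding K_def by blast
      then have "card (\<sigma> l) \<le> card (\<pi> ` \<sigma> l) + k"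
        using card_fibre_excess_mono[OF finite_subset[OF suppE[OF x(1)] E] x(2), of \<pi>] k[OF x(1)] by linarith
      then have "covering_dim_le (subtopology (powertop_real UNIV) (?A (\<sigma> l))) k"
        using covering_dim_le_simplex_fibre[OF E KE[OF \<sigma>K[OF l]], of \<pi> k y] unfolding p_eq by simp
      then show "covering_dim_le (subtopology (subtopology (powertop_real UNIV) ?S) (?A (\<sigma> l))) k"
        using sub[OF l] by (simp add: subtopology_subtopology inf_absorb2)
    next
      show "topspace (subtopology (powertop_real UNIV) ?S) \<subseteq> (\<Union>l<q. ?A (\<sigma> l))"
        using \<sigma> by (auto simp: topspace_polyhedron_of)
    qed
    then show ?thesis unfolding eq .
  qed
  then have dim_p: "dimensional_map k (polyhedron_of K) (polyhedron_of L) p"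
    using contp by (simp add: dimensional_map_def)
  have "p (\<kappa> x) = \<mu> (f x)" if "x \<in> topspace X" for x
    using compat[OF that] by (simp add: p_def fun_eq_iff)
  then show ?thesis using lfK lfL oX oY simp_p dim_p by blast
qed

section \<open>Approximation by simplicial maps\<close>

text \<open>The coordinates are indexed by pairs and the vertices are natural numbers; the excess is
  computed with either.\<close>

lemma card_pairing_fst:
  assumes "finite S"
  shows "card {v. prod_decode v \<in> S} = card S"
    and "(fst \<circ> prod_decode) ` {v. prod_decode v \<in> S} = fst ` S"
proof -
  have "{v. prod_decode v \<in> S} = prod_encode ` S"
    by (force simp: image_iff intro: prod_decode_inverse[symmetric])
  then show "card {v. prod_decode v \<in> S} = card S"
    and "(fst \<circ> prod_decode) ` {v. prod_decode v \<in> S} = fst ` S"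
    by (auto simp: card_image inj_prod_encode image_image)
qed

text \<open>The weights \<open>\<phi>\<close> are the coordinates of \<open>Y\<close>, and each
  pulled back weight is split among the vertices over its index.\<close>

lemma simplicial_approximation_if_thin_cover:
  fixes \<phi> :: "nat \<Rightarrow> 'b \<Rightarrow> real" and \<psi> :: "nat \<Rightarrow> 'a \<Rightarrow> real"
  assumes f: "continuous_map X Y f"
    and \<phi>: "\<And>i. i < n \<Longrightarrow> continuous_map Y euclideanreal (\<phi> i)" "\<And>i y. y \<in> topspace Y \<Longrightarrow> 0 \<le> \<phi> i y"
      "\<And>i y. \<lbrakk>i < n; y \<in> topspace Y; y \<notin> U i\<rbrakk> \<Longrightarrow> \<phi> i y = 0" "\<And>y. y \<in> topspace Y \<Longrightarrow> (\<Sum>i<n. \<phi> i y) = 1"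
    and U: "\<And>i. i < n \<Longrightarrow> \<exists>W\<in>\<eta>. U i \<subseteq> W"
    and V: "\<And>i. i < n \<Longrightarrow> thin_partition X Y f \<omega> G (U i) (V i)"
    and \<psi>: "\<And>c. c < r \<Longrightarrow> continuous_map (subtopology X G) euclideanreal (\<psi> c)"
      "\<And>c x. x \<in> topspace X \<Longrightarrow> 0 \<le> \<psi> c x" "\<And>x. x \<in> G \<Longrightarrow> (\<Sum>c<r. \<psi> c x) = 1"
    and small: "\<And>c. c < r \<Longrightarrow> \<exists>W\<in>\<omega>. {x \<in> topspace X. 0 < \<psi> c x} \<subseteq> W"
    and order: "\<And>x. x \<in> topspace X \<Longrightarrow> card {c. c < r \<and> 0 < \<psi> c x} \<le> k + 1"
  shows "\<exists>(K :: nat set set) (L :: nat set set) \<kappa>X \<kappa>Y p.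
           locally_finite_complex K \<and> locally_finite_complex L \<and>
           omega_map X \<omega> (polyhedron_of K) \<kappa>X \<and>
           omega_map Y \<eta> (polyhedron_of L) \<kappa>Y \<and>
           simplicial_map_between K L p \<and>
           dimensional_map k (polyhedron_of K) (polyhedron_of L) p \<and>
           (\<forall>x \<in> topspace X. p (\<kappa>X x) = \<kappa>Y (f x))"
proof -
  define a where "a i x = \<phi> i (f x)" for i x
  define co where "co x = thick_thin_coordinates n r V a \<psi> x" for x
  have fX: "f x \<in> topspace Y" if "x \<in> topspace X" for x using f that by (auto simp: continuous_map_def)
  have Vop: "openin X (V i j)" and disj: "disjoint_family (V i)" and VG: "V i 0 \<subseteq> G"
    and Vsmall: "\<lbrakk>j > 0; V i j \<noteq> {}\<rbrakk> \<Longrightarrow> \<exists>W\<in>\<omega>. V i j \<subseteq> W" and finV: "finite {j. V i j \<noteq> {}}"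
    and Vcov: "{x \<in> topspace X. f x \<in> U i} = (\<Union>j. V i j)" if "i < n" for i j
    using V[OF that] by (auto simp: thin_partition_def)
  have a: "0 \<le> a i x" "(\<Sum>i<n. a i x) = 1" if "x \<in> topspace X" for i x
    using \<phi>(2,4) fX[OF that] by (auto simp: a_def)
  have conta: "continuous_map X euclideanreal (a i)" if "i < n" for i
    using continuous_map_compose[OF f \<phi>(1)[OF that]] by (simp add: a_def[abs_def] comp_def)
  have cover: "x \<in> (\<Union>j. V i j)" if "i < n" "x \<in> topspace X" "0 < a i x" for i x
    using \<phi>(3)[OF that(1) fX[OF that(2)]] that Vcov[OF that(1)] by (force simp: a_def)
  have \<psi>1: "(\<Sum>c<r. \<psi> c x) = 1" if "i < n" "x \<in> V i 0" for i x
    using \<psi>(3) VG[OF that(1)] that(2) by blast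
  have co_cont: "continuous_map X euclideanreal (\<lambda>x. co x v)" for v
    unfolding co_def
  proof (rule continuous_map_thick_thin_coordinates)
    show "continuous_map (subtopology X (V i 0)) euclideanreal (\<psi> c)" if "i < n" "c < r" for i c
      using \<psi>(1)[OF that(2)] VG[OF that(1)] by (rule continuous_map_from_subtopology_mono)
    show "continuous_map X euclideanreal (a i)" if "i < n" for i using that by (rule conta)
    show "0 \<le> a i x" "(\<Sum>i<n. a i x) = 1" if "x \<in> topspace X" for i x
      using that by (fact a)+
    show "0 \<le> \<psi> c x" if "x \<in> topspace X" for c x using that by (rule \<psi>(2))
    show "(\<Sum>c<r. \<psi> c x) = 1" if "i < n" "x \<in> V i 0" for i x using that by (rule \<psi>1)
    show "openin X (V i j)" if "i < n" for i j using that by (rule Vop)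
    show "disjoint_family (V i)" if "i < n" for i using that by (rule disj)
    show "x \<in> (\<Union>j. V i j)" if "i < n" "x \<in> topspace X" "0 < a i x" for i x
      using that by (rule cover)
  qed
  have co_nn: "0 \<le> co x v" if "x \<in> topspace X" for x v
    unfolding co_def
    by (rule thick_thin_coordinates_nonneg, (rule a[OF that] \<psi>(2)[OF that] | erule (1) \<psi>1 | erule disj | erule (1) cover[OF _ that])+)
  have co_0: "co x (i, s) = 0" if "\<not> i < n" for x i s
    using that by (simp add: co_def thick_thin_coordinates_def)
  have "finite (\<Union>i<n. {j. V i j \<noteq> {}})" using finV by auto
  then obtain m where m: "\<And>i j. \<lbrakk>i < n; V i j \<noteq> {}\<rbrakk> \<Longrightarrow> j < m"
    unfolding finite_nat_set_iff_bounded by auto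
  \<comment> \<open>Even second indices occur below \<open>2 * r\<close>, and odd ones below
    \<open>2 * m\<close> because nonempty pieces have index less than \<open>m\<close>.\<close>
  define s where "s = 2 * (r + m)"
  have s: "2 * r \<le> s" "\<And>i j. \<lbrakk>i < n; V i j \<noteq> {}\<rbrakk> \<Longrightarrow> 2 * j < s" using m by (force simp: s_def)+
  have co_s: "co x (i, t) = 0" if "\<not> t < s" for x i t
  proof (cases "i < n")
    case True
    have "\<not> t div 2 < r" "\<not> t div 2 < m" using that by (auto simp: s_def)
    moreover have "V i (Suc (t div 2)) = {}"
      using m[OF True, of "Suc (t div 2)"] calculation by auto
    ultimately show ?thesis by (simp add: co_def thick_thin_coordinates_def)
  qed (rule co_0)
  have co_sum: "(\<Sum>t<s. co x (i, t)) = a i x" if "x \<in> topspace X" "i < n" for x i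
    unfolding co_def
    by (rule sum_thick_thin_coordinates, (rule a[OF that(1)] \<psi>(2)[OF that(1)] that(2) s(1) | erule s(2)[OF that(2)] | erule (1) \<psi>1 | erule disj | erule (1) cover[OF _ that(1)])+)
  have co_card: "finite {v. 0 < co x v} \<and> card {v. 0 < co x v} \<le> card (fst ` {v. 0 < co x v}) + k"
    if "x \<in> topspace X" for x
    unfolding co_def
    by (rule card_thick_thin_support, (rule a[OF that] \<psi>(2)[OF that] order[OF that] | erule (1) \<psi>1 | erule disj | erule (1) cover[OF _ that])+)
  define E where "E = prod_encode ` ({..<n} \<times> {..<s})"
  define \<kappa> where "\<kappa> x v = co x (prod_decode v)" for x v
  define \<mu> where "\<mu> y w = (if w < n then \<phi> w y else 0)" for y w
  show ?thesis
  proof (rule simplicial_approximation_from_coordinates[where \<kappa> = \<kappa> and \<mu> = \<mu> and E = E and F = "{..<n}"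
        and \<pi> = "fst \<circ> prod_decode", OF f])
    show "finite E" "finite {..<n}" "(fst \<circ> prod_decode) ` E \<subseteq> {..<n}" by (auto simp: E_def)
    show "continuous_map X euclideanreal (\<lambda>x. \<kappa> x v)" for v unfolding \<kappa>_def by (rule co_cont)
    show "continuous_map Y euclideanreal (\<lambda>y. \<mu> y w)" for w
      using \<phi>(1) by (cases "w < n") (simp_all add: \<mu>_def)
    show "0 \<le> \<kappa> x v" if "x \<in> topspace X" for x v unfolding \<kappa>_def using that by (rule co_nn)
    show "0 \<le> \<mu> y w" if "y \<in> topspace Y" for y w using \<phi>(2) that by (simp add: \<mu>_def)
    show "\<kappa> x v = 0" if "v \<notin> E" for x v
    proof -
      obtain i t where it: "prod_decode v = (i, t)" by fastforce
      then have "v = prod_encode (i, t)" by (metis prod_decode_inverse)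
      then have "\<not> i < n \<or> \<not> t < s" using that by (auto simp: E_def)
      then show ?thesis using co_0 co_s it by (auto simp: \<kappa>_def)
    qed
    show "\<mu> y w = 0" if "w \<notin> {..<n}" for y w using that by (simp add: \<mu>_def)
    show "(\<Sum>w<n. \<mu> y w) = 1" if "y \<in> topspace Y" for y using \<phi>(4)[OF that] by (simp add: \<mu>_def)
    show "(\<Sum>v\<in>{v \<in> E. (fst \<circ> prod_decode) v = w}. \<kappa> x v) = \<mu> (f x) w" if x: "x \<in> topspace X" for x w
    proof (cases "w < n")
      case True
      then have "{v \<in> E. (fst \<circ> prod_decode) v = w} = (\<lambda>t. prod_encode (w, t)) ` {..<s}"
        by (auto simp: E_def)
      moreover have "inj_on (\<lambda>t. prod_encode (w, t)) {..<s}"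
        by (auto simp: inj_on_def prod_encode_eq)
      ultimately have "(\<Sum>v\<in>{v \<in> E. (fst \<circ> prod_decode) v = w}. \<kappa> x v) = (\<Sum>t<s. co x (w, t))"
        by (simp add: sum.reindex \<kappa>_def)
      then show ?thesis using co_sum[OF x True] True by (simp add: a_def \<mu>_def)
    next
      case False
      then have "{v \<in> E. (fst \<circ> prod_decode) v = w} = {}" by (auto simp: E_def)
      then show ?thesis using False by (simp only: sum.empty) (simp add: \<mu>_def)
    qed
    show "\<exists>W\<in>\<omega>. {z \<in> topspace X. 0 < \<kappa> z v} \<subseteq> W" if x: "x \<in> topspace X" "0 < \<kappa> x v" for x v
    proof -
      obtain i t where it: "prod_decode v = (i, t)" by fastforce
      have i: "i < n" using x(2) co_0[of i x t] it by (auto simp: \<kappa>_def)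
      show ?thesis
      proof (cases "even t")
        case True
        then have pos: "t div 2 < r \<and> z \<in> V i 0 \<and> 0 < overlap (\<lambda>i. \<Sum>j<i. a j z) (\<lambda>c. \<Sum>j<c. \<psi> j z) i (t div 2)"
          if "0 < \<kappa> z v" for z
          using that it i by (auto simp: \<kappa>_def co_def thick_thin_coordinates_def split: if_splits)
        \<comment> \<open>A positive overlap needs an interval of positive length on the side of
          \<open>\<psi>\<close>, and that length is the value of \<open>\<psi>\<close>
          itself.\<close>
        have "0 < \<psi> (t div 2) z" if z: "z \<in> topspace X" "0 < \<kappa> z v" for z
          using overlap_pos(2)[OF conjunct2[OF conjunct2[OF pos[OF z(2)]]]] a(1)[OF z(1)] \<psi>(2)[OF z(1)] by simp
        then have "{z \<in> topspace X. 0 < \<kappa> z v} \<subseteq> {z \<in> topspace X. 0 < \<psi> (t div 2) z}" by blast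
        then show ?thesis using small[OF conjunct1[OF pos[OF x(2)]]] by blast
      next
        case False
        have "z \<in> V i (Suc (t div 2))" if "0 < \<kappa> z v" for z
          using that it i False by (auto simp: \<kappa>_def co_def thick_thin_coordinates_def split: if_splits)
        then have "{z \<in> topspace X. 0 < \<kappa> z v} \<subseteq> V i (Suc (t div 2))" "V i (Suc (t div 2)) \<noteq> {}"
          using x(2) by blast+
        then show ?thesis using Vsmall[OF i, of "Suc (t div 2)"] by blast
      qed
    qed
    show "\<exists>W\<in>\<eta>. {z \<in> topspace Y. 0 < \<mu> z w} \<subseteq> W" if "y \<in> topspace Y" "0 < \<mu> y w" for y w
    proof -
      have w: "w < n" using that(2) by (simp add: \<mu>_def split: if_splits)
      then have "{z \<in> topspace Y. 0 < \<mu> z w} \<subseteq> U w" using \<phi>(3)[OF w] by (force simp: \<mu>_def)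
      then show ?thesis using U[OF w] by blast
    qed
    show "card {v. 0 < \<kappa> x v} \<le> card ((fst \<circ> prod_decode) ` {v. 0 < \<kappa> x v}) + k" if x: "x \<in> topspace X" for x
      using card_pairing_fst[of "{v. 0 < co x v}"] co_card[OF x] by (simp add: \<kappa>_def)
  qed
qed

theorem theorem1p3:
  fixes k :: nat and X :: "'a topology" and Y :: "'b topology" and f :: "'a \<Rightarrow> 'b"
  assumes "Bing_compactum X"
    and "compactum Y"
    and "dimensional_map k X Y f"
  shows "admits_simplicial_approximation k X Y f"
  unfolding admits_simplicial_approximation_def
proof (intro allI impI)
  fix \<omega>X :: "'a set set" and \<omega>Y :: "'b set set"
  assume covers: "open_cover_of X \<omega>X \<and> open_cover_of Y \<omega>Y"
  then have \<omega>: "open_cover_of X \<omega>X" and \<eta>: "open_cover_of Y \<omega>Y" by auto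
  let ?B = "thick_part X Y f \<omega>X"
  have X: "compactum X" using assms(1) by (simp add: Bing_compactum_def)
  have f: "continuous_map X Y f" using assms(3) by (simp add: dimensional_map_def)
  have X': "compact_space X" "metrizable_space X" "completely_regular_space X"
    and Y': "compact_space Y" "completely_regular_space Y"
    using X assms(2) metrizable_imp_completely_regular_space by (auto simp: compactum_def)
  have B: "compactin X ?B" using X'(1) closedin_thick_part by (rule closedin_compact_space)
  have "\<And>W. W \<in> \<omega>X \<Longrightarrow> openin X W" "?B \<subseteq> \<Union>\<omega>X"
    using \<omega> compactin_subset_topspace[OF B] by (auto simp: open_cover_of_def)
  then obtain \<F> where \<F>: "finite \<F>" "\<F> \<subseteq> \<omega>X" "?B \<subseteq> \<Union>\<F>"
    using compactinD[OF B] by metis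
  obtain W and r :: nat where W: "\<F> = W ` {..<r}"
    using \<F>(1) by (metis finite_imp_nat_seg_image_inj_on lessThan_def)
  have Wop: "openin X (W c)" and W\<omega>: "W c \<in> \<omega>X" if "c < r" for c
    using that W \<F>(2) \<omega> by (auto simp: open_cover_of_def)
  have BW: "?B \<subseteq> (\<Union>c<r. W c)" using \<F>(3) W by simp
  \<comment> \<open>The sets are taken open in \<open>X\<close> with the order bounded everywhere,
    because the coordinates built from them live on a neighbourhood of the thick part.\<close>
  obtain V0 where V0: "shrinking_of_order X ?B k r W V0"
    using compact_covering_dim_le_shrinking[OF X'(2) B covering_dim_le_thick_part[OF assms \<omega>], of r W] Wop BW
    by blast
  then have V0': "\<And>c. c < r \<Longrightarrow> openin X (V0 c)" "\<And>c. c < r \<Longrightarrow> V0 c \<subseteq> W c" "?B \<subseteq> (\<Union>c<r. V0 c)"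
    "\<And>x. x \<in> topspace X \<Longrightarrow> card {c. c < r \<and> x \<in> V0 c} \<le> k + 1"
    by (auto simp: shrinking_of_order_def)
  obtain \<psi> :: "nat \<Rightarrow> 'a \<Rightarrow> real" where \<psi>: "\<And>c. continuous_map X euclideanreal (\<psi> c)"
    "\<And>c x. x \<in> topspace X \<Longrightarrow> 0 \<le> \<psi> c x" "\<And>c x. \<lbrakk>c < r; x \<in> topspace X; x \<notin> V0 c\<rbrakk> \<Longrightarrow> \<psi> c x = 0"
    "\<And>x. x \<in> ?B \<Longrightarrow> 0 < (\<Sum>c<r. \<psi> c x)"
    using bump_functions[OF X'(3) B V0'(1,3)] by metis
  \<comment> \<open>This is where the bumps can be normalized; it is open and contains the thick
    part, as the partitions require.\<close>
  define G where "G = {x \<in> topspace X. (\<Sum>c<r. \<psi> c x) \<in> {0<..}}"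
  have Gop: "openin X G"
    unfolding G_def using \<psi>(1)
    by (intro openin_continuous_map_preimage[where Y = euclideanreal] continuous_map_sum) auto
  have BG: "?B \<subseteq> G" using \<psi>(4) compactin_subset_topspace[OF B] by (auto simp: G_def)
  obtain n :: nat and U V where UV: "\<And>i. i < n \<Longrightarrow> openin Y (U i)" "\<And>i. i < n \<Longrightarrow> \<exists>W\<in>\<omega>Y. U i \<subseteq> W"
    "topspace Y \<subseteq> (\<Union>i<n. U i)" "\<And>i. i < n \<Longrightarrow> thin_partition X Y f \<omega>X G (U i) (V i)"
    using thin_partition_cover[OF X assms(2) f Gop BG \<eta>] by metis
  have cY: "compactin Y (topspace Y)" using Y'(1) by (simp add: compact_space_def)
  obtain \<phi> :: "nat \<Rightarrow> 'b \<Rightarrow> real" where \<phi>: "\<And>i. continuous_map Y euclideanreal (\<phi> i)"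
    "\<And>i y. y \<in> topspace Y \<Longrightarrow> 0 \<le> \<phi> i y" "\<And>i y. \<lbrakk>i < n; y \<in> topspace Y; y \<notin> U i\<rbrakk> \<Longrightarrow> \<phi> i y = 0"
    "\<And>y. y \<in> topspace Y \<Longrightarrow> 0 < (\<Sum>i<n. \<phi> i y)"
    using bump_functions[OF Y'(2) cY UV(1,3)] by metis
  define \<phi>1 where "\<phi>1 i y = \<phi> i y / (\<Sum>j<n. \<phi> j y)" for i y
  \<comment> \<open>Outside \<open>G\<close> the sum is 0, and division by 0 yields 0. Hence
    \<open>\<psi>1\<close> is nonnegative on all of \<open>X\<close> and still positive only inside
    the sets \<open>V0 c\<close>.\<close>
  define \<psi>1 where "\<psi>1 c x = \<psi> c x / (\<Sum>j<r. \<psi> j x)" for c x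
  have \<psi>sum: "0 \<le> (\<Sum>j<r. \<psi> j x)" if "x \<in> topspace X" for x using \<psi>(2)[OF that] by (simp add: sum_nonneg)
  have \<psi>pos: "x \<in> V0 c" if "c < r" "x \<in> topspace X" "0 < \<psi>1 c x" for c x
    using \<psi>(3)[OF that(1,2)] that(3) by (force simp: \<psi>1_def)
  show "\<exists>(K :: nat set set) (L :: nat set set) \<kappa>X \<kappa>Y p.
           locally_finite_complex K \<and> locally_finite_complex L \<and>
           omega_map X \<omega>X (polyhedron_of K) \<kappa>X \<and>
           omega_map Y \<omega>Y (polyhedron_of L) \<kappa>Y \<and>
           simplicial_map_between K L p \<and>
           dimensional_map k (polyhedron_of K) (polyhedron_of L) p \<and>
           (\<forall>x \<in> topspace X. p (\<kappa>X x) = \<kappa>Y (f x))"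
  proof (rule simplicial_approximation_if_thin_cover[where \<phi> = \<phi>1 and \<psi> = \<psi>1, OF f])
    show "continuous_map Y euclideanreal (\<phi>1 i)" for i
      unfolding \<phi>1_def using \<phi>(1) less_imp_neq[OF \<phi>(4)]
      by (intro continuous_map_real_divide continuous_map_sum) auto
    show "0 \<le> \<phi>1 i y" if "y \<in> topspace Y" for i y
      using \<phi>(2)[OF that, of i] \<phi>(4)[OF that] by (simp add: \<phi>1_def)
    show "\<phi>1 i y = 0" if "i < n" "y \<in> topspace Y" "y \<notin> U i" for i y
      using \<phi>(3)[OF that] by (simp add: \<phi>1_def)
    show "(\<Sum>i<n. \<phi>1 i y) = 1" if "y \<in> topspace Y" for y
      using \<phi>(4)[OF that] by (simp add: \<phi>1_def flip: sum_divide_distrib)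
    show "continuous_map (subtopology X G) euclideanreal (\<psi>1 c)" for c
      unfolding \<psi>1_def using \<psi>(1)
      by (intro continuous_map_real_divide continuous_map_sum continuous_map_from_subtopology) (auto simp: G_def)
    show "0 \<le> \<psi>1 c x" if "x \<in> topspace X" for c x
      using \<psi>(2)[OF that, of c] \<psi>sum[OF that] by (simp add: \<psi>1_def)
    show "(\<Sum>c<r. \<psi>1 c x) = 1" if "x \<in> G" for x
      using that by (simp add: \<psi>1_def G_def flip: sum_divide_distrib)
    show "\<exists>W\<in>\<omega>X. {x \<in> topspace X. 0 < \<psi>1 c x} \<subseteq> W" if "c < r" for c
      using \<psi>pos[OF that] V0'(2)[OF that] W\<omega>[OF that] by (intro bexI[of _ "W c"]) auto
    show "card {c. c < r \<and> 0 < \<psi>1 c x} \<le> k + 1" if x: "x \<in> topspace X" for x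
    proof -
      have "card {c. c < r \<and> 0 < \<psi>1 c x} \<le> card {c. c < r \<and> x \<in> V0 c}"
        using \<psi>pos[OF _ x] by (intro card_mono) auto
      then show ?thesis using V0'(4)[OF x] by linarith
    qed
    show "\<exists>W\<in>\<omega>Y. U i \<subseteq> W" if "i < n" for i using that by (rule UV(2))
    show "thin_partition X Y f \<omega>X G (U i) (V i)" if "i < n" for i using that by (rule UV(4))
  qed
qed

end
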